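(* Let $w\ge 1$ be an integer window size, let $\hat{\boldsymbol\theta}:(\mathbb R^K)^w\to\mathbb R^K$ be any (measurable) estimator, let $\boldsymbol\theta\in\boldsymbol\Theta$ be the post-change mean, let $\gamma\ge 1$, and let $b=\log\gamma$. Let $T_b^{\mathrm{WL}}$ be the window-limited CuSum (WL-CuSum) stopping time with window size $w$, estimator $\hat{\boldsymbol\theta}$ and threshold $b$. Suppose that $w$ is large enough that $$\mathsf I(\boldsymbol\theta)-\tfrac12\,\mathsf{MSE}_{\boldsymbol\theta}(\hat{\boldsymbol\theta}_{1,w+1})>0 .$$ Then $\mathbb E_\infty(T_b^{\mathrm{WL}})\ge\gamma$ and $$\mathcal D^{\boldsymbol\theta}(T_b^{\mathrm{WL}})\le\frac{b+(w+1)\,\mathsf I(\boldsymbol\theta)+2}{\mathsf I(\boldsymbol\theta)-\frac12\,\mathsf{MSE}_{\boldsymbol\theta}(\hat{\boldsymbol\theta}_{1,w+1})}.$$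
   Context: Model. Let $K\ge 3$ and $\boldsymbol\Theta\subseteq\mathbb R^K\setminus\{\mathbf 0\}$. The observations $\mathbf X_1,\mathbf X_2,\dots$ are independent random vectors in $\mathbb R^K$. For a deterministic unknown change-point $\nu\ge 1$ and $\boldsymbol\theta\in\boldsymbol\Theta$, under $\mathbb P_\nu^{\boldsymbol\theta}$ (expectation $\mathbb E_\nu^{\boldsymbol\theta}$) one has $\mathbf X_n\sim\mathcal N(\mathbf 0,\mathbf I)$ for $n<\nu$ and $\mathbf X_n\sim\mathcal N(\boldsymbol\theta,\mathbf I)$ for $n\ge\nu$. Under $\mathbb P_\infty$ (expectation $\mathbb E_\infty$) all $\mathbf X_n\sim\mathcal N(\mathbf 0,\mathbf I)$. Let $\mathcal F_n=\sigma(\mathbf X_1,\dots,\mathbf X_n)$ ($\mathcal F_0$ trivial). Delay. For a stopping time $T$ with respect to $\{\mathcal F_n\}$, the worst-case (Lorden) detection delay is $$\mathcal D^{\boldsymbol\theta}(T)=\sup_{\nu\ge1}\ \operatorname{ess\,sup}\ \mathbb E_\nu^{\boldsymbol\theta}\big((T-\nu+1)^+\mid\mathcal F_{\nu-1}\big),\qquad z^+=\max(0,z).$$ Kullback-Leibler divergence: $\mathsf I(\boldsymbol\theta)=\|\boldsymbol\theta\|^2/2$. Estimator notation. $\hat{\boldsymbol\theta}_{n-w,n}=\hat{\boldsymbol\theta}(\mathbf X_{n-w},\dots,\mathbf X_{n-1})$ for $n>w$, and $\mathsf{MSE}_{\boldsymbol\theta}(\hat{\boldsymbol\theta}_{1,w+1})=\mathbb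 E_1^{\boldsymbol\theta}\|\boldsymbol\theta-\hat{\boldsymbol\theta}(\mathbf X_1,\dots,\mathbf X_w)\|^2$. WL-CuSum test. Put $S_0=\dots=S_w=0$ and, for $n>w$, $$S_n=S_{n-1}^++\hat{\boldsymbol\theta}_{n-w,n}^\top\mathbf X_n-\tfrac12\|\hat{\boldsymbol\theta}_{n-w,n}\|^2,\qquad T_b^{\mathrm{WL}}=\inf\{n>w:S_n>b\}.$$ *)

theory Defs
  imports "HOL-Probability.Probability"
begin

section \<open>Gaussian observations with a change in mean\<close>

definition mvn_density :: "real ^ 'k \<Rightarrow> real ^ 'k \<Rightarrow> ennreal" where
  "mvn_density m x =
     ennreal ((2 * pi) powr (- real CARD('k) / 2) * exp (- (norm (x - m))\<^sup>2 / 2))"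

text \<open>Observation times start at 1; the value \<open>X 0\<close> of an observation sequence is never used.\<close>

definition gaussian_observations ::
    "'a measure \<Rightarrow> (nat \<Rightarrow> 'a \<Rightarrow> real ^ 'k) \<Rightarrow> (nat \<Rightarrow> real ^ 'k) \<Rightarrow> bool" where
  "gaussian_observations M X \<mu> \<longleftrightarrow>
     prob_space M \<and>
     prob_space.indep_vars M (\<lambda>_. borel) X {1..} \<and>
     (\<forall>n\<ge>1. distributed M lborel (X n) (mvn_density (\<mu> n)))"

text \<open>
  The law \<open>Pinf\<close> and the laws \<open>P \<nu> \<theta>\<close> live on one measurable space, which carries the
  observations; \<open>P\<close> is only constrained for \<open>\<nu> \<ge> 1\<close> and \<open>\<theta> \<in> \<Theta>\<close>.
\<close>

definition change_point_model ::
    "(real ^ 'k) set \<Rightarrow> 'a measure \<Rightarrow> (nat \<Rightarrow> real ^ 'k \<Rightarrow> 'a measure)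
      \<Rightarrow> (nat \<Rightarrow> 'a \<Rightarrow> real ^ 'k) \<Rightarrow> bool" where
  "change_point_model \<Theta> Pinf P X \<longleftrightarrow>
     gaussian_observations Pinf X (\<lambda>_. 0) \<and>
     (\<forall>\<nu>\<ge>1. \<forall>\<theta>\<in>\<Theta>.
        sets (P \<nu> \<theta>) = sets Pinf \<and>
        gaussian_observations (P \<nu> \<theta>) X (\<lambda>n. if n < \<nu> then 0 else \<theta>))"

definition obs_filtration :: "'a set \<Rightarrow> (nat \<Rightarrow> 'a \<Rightarrow> real ^ 'k) \<Rightarrow> nat \<Rightarrow> 'a measure" where
  "obs_filtration \<Omega> X n = sigma \<Omega> (\<Union>i\<in>{1..n}. {X i -` A \<inter> \<Omega> | A. A \<in> sets borel})"


section \<open>Worst-case delay, divergence and estimation error\<close>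

text \<open>Subtraction on \<^typ>\<open>enat\<close> truncates at 0 and satisfies \<open>\<infinity> - enat \<nu> = \<infinity>\<close>, so
  \<open>T \<omega> + 1 - enat \<nu>\<close> is the positive part of \<open>T - \<nu> + 1\<close>.\<close>

definition lorden_delay ::
    "(nat \<Rightarrow> real ^ 'k \<Rightarrow> 'a measure) \<Rightarrow> (nat \<Rightarrow> 'a \<Rightarrow> real ^ 'k) \<Rightarrow> real ^ 'k
      \<Rightarrow> ('a \<Rightarrow> enat) \<Rightarrow> ennreal" where
  "lorden_delay P X \<theta> T =
     (SUP \<nu>\<in>{1..}. esssup (P \<nu> \<theta>)
        (nn_cond_exp (P \<nu> \<theta>) (obs_filtration (space (P \<nu> \<theta>)) X (\<nu> - 1))
           (\<lambda>\<omega>. ennreal_of_enat (T \<omega> + 1 - enat \<nu>))))"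

definition kl_divergence :: "real ^ 'k \<Rightarrow> real" where
  "kl_divergence \<theta> = (norm \<theta>)\<^sup>2 / 2"

text \<open>
  An estimator with window \<open>w\<close> is a function of \<open>w\<close>-tuples, i.e. of elements of
  \<open>{..<w} \<rightarrow>\<^sub>E UNIV\<close>. Applied along a path \<open>x\<close>, the window at time \<open>n > w\<close> is
  \<open>x (n - w), \<dots>, x (n - 1)\<close>.
\<close>

definition window_estimate ::
    "nat \<Rightarrow> ((nat \<Rightarrow> real ^ 'k) \<Rightarrow> real ^ 'k) \<Rightarrow> (nat \<Rightarrow> real ^ 'k) \<Rightarrow> nat \<Rightarrow> real ^ 'k" where
  "window_estimate w est x n = est (\<lambda>i\<in>{..<w}. x (n - w + i))"

text \<open>The mean square error may be infinite, hence the value in \<^typ>\<open>ennreal\<close>. At time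
  \<open>w + 1\<close> the window is \<open>X 1, \<dots>, X w\<close>.\<close>

definition window_mse ::
    "(nat \<Rightarrow> real ^ 'k \<Rightarrow> 'a measure) \<Rightarrow> (nat \<Rightarrow> 'a \<Rightarrow> real ^ 'k) \<Rightarrow> nat
      \<Rightarrow> ((nat \<Rightarrow> real ^ 'k) \<Rightarrow> real ^ 'k) \<Rightarrow> real ^ 'k \<Rightarrow> ennreal" where
  "window_mse P X w est \<theta> =
     (\<integral>\<^sup>+ \<omega>. ennreal ((norm (\<theta> - window_estimate w est (\<lambda>i. X i \<omega>) (w + 1)))\<^sup>2) \<partial>P 1 \<theta>)"


section \<open>The window-limited CuSum test\<close>

primrec wl_cusum ::
    "nat \<Rightarrow> ((nat \<Rightarrow> real ^ 'k) \<Rightarrow> real ^ 'k) \<Rightarrow> (nat \<Rightarrow> real ^ 'k) \<Rightarrow> nat \<Rightarrow> real" where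
  "wl_cusum w est x 0 = 0"
| "wl_cusum w est x (Suc n) =
     (if Suc n \<le> w then 0
      else max 0 (wl_cusum w est x n)
           + window_estimate w est x (Suc n) \<bullet> x (Suc n)
           - (norm (window_estimate w est x (Suc n)))\<^sup>2 / 2)"

definition wl_cusum_time ::
    "nat \<Rightarrow> ((nat \<Rightarrow> real ^ 'k) \<Rightarrow> real ^ 'k) \<Rightarrow> (nat \<Rightarrow> 'a \<Rightarrow> real ^ 'k) \<Rightarrow> real
      \<Rightarrow> 'a \<Rightarrow> enat" where
  "wl_cusum_time w est X b \<omega> =
     Inf {enat n | n. n > w \<and> wl_cusum w est (\<lambda>i. X i \<omega>) n > b}"


section \<open>Measurability\<close>

text \<open>\<^const>\<open>nn_cond_exp\<close> and \<^const>\<open>esssup\<close> take default values outside their intended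
  domains. The following facts show that the delay of the test does not involve these.\<close>

lemma space_obs_filtration [simp]: "space (obs_filtration \<Omega> X n) = \<Omega>"
  unfolding obs_filtration_def by (rule space_measure_of) auto

lemma sets_obs_filtration:
  "sets (obs_filtration \<Omega> X n) =
     sigma_sets \<Omega> (\<Union>i\<in>{1..n}. {X i -` A \<inter> \<Omega> | A. A \<in> sets borel})"
  unfolding obs_filtration_def by (rule sets_measure_of) auto

lemma obs_filtration_mono:
  assumes "m \<le> n"
  shows "sets (obs_filtration \<Omega> X m) \<subseteq> sets (obs_filtration \<Omega> X n)"
proof -
  have "{1..m} \<subseteq> {1..n}" using assms by auto
  then show ?thesis
    unfolding sets_obs_filtration by (intro sigma_sets_mono' UN_mono) auto
qed

lemma measurable_obs_filtration:
  fixes X :: "nat \<Rightarrow> 'a \<Rightarrow> real ^ 'k"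
  assumes "1 \<le> i" "i \<le> n"
  shows "X i \<in> borel_measurable (obs_filtration \<Omega> X n)"
proof (rule measurableI)
  fix A :: "(real ^ 'k) set" assume "A \<in> sets borel"
  then have "X i -` A \<inter> \<Omega> \<in> (\<Union>i\<in>{1..n}. {X i -` A \<inter> \<Omega> | A. A \<in> sets borel})"
    using assms by (intro UN_I[of i]) auto
  then show "X i -` A \<inter> space (obs_filtration \<Omega> X n) \<in> sets (obs_filtration \<Omega> X n)"
    unfolding sets_obs_filtration space_obs_filtration by (rule sigma_sets.Basic)
qed simp

lemma subalgebra_obs_filtration:
  assumes "\<And>i. 1 \<le> i \<Longrightarrow> X i \<in> borel_measurable M"
  shows "subalgebra M (obs_filtration (space M) X n)"
proof -
  have "(\<Union>i\<in>{1..n}. {X i -` A \<inter> space M | A. A \<in> sets borel}) \<subseteq> sets M"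
    using assms measurable_sets by fastforce
  then show ?thesis
    unfolding subalgebra_def sets_obs_filtration
    by (simp add: sets.sigma_sets_subset)
qed

lemma measurable_window_estimate:
  assumes est: "est \<in> borel_measurable (PiM {..<w} (\<lambda>_. borel))"
    and X: "\<And>i. 1 \<le> i \<Longrightarrow> i < n \<Longrightarrow> X i \<in> borel_measurable F"
    and n: "n > w"
  shows "(\<lambda>\<omega>. window_estimate w est (\<lambda>i. X i \<omega>) n) \<in> borel_measurable F"
  unfolding window_estimate_def
  by (rule measurable_compose[OF _ est], rule measurable_restrict, rule X) (use n in auto)

lemma measurable_wl_cusum:
  assumes est: "est \<in> borel_measurable (PiM {..<w} (\<lambda>_. borel))"
    and X: "\<And>i. 1 \<le> i \<Longrightarrow> i \<le> n \<Longrightarrow> X i \<in> borel_measurable F"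
  shows "(\<lambda>\<omega>. wl_cusum w est (\<lambda>i. X i \<omega>) n) \<in> borel_measurable F"
  using X
proof (induction n)
  case (Suc n)
  note IH = Suc.IH[OF Suc.prems]
  show ?case
  proof (cases "Suc n \<le> w")
    case False
    then have [measurable]: "(\<lambda>\<omega>. window_estimate w est (\<lambda>i. X i \<omega>) (Suc n)) \<in> borel_measurable F"
      using Suc.prems by (intro measurable_window_estimate[OF est]) auto
    have [measurable]: "X (Suc n) \<in> borel_measurable F" using Suc.prems by auto
    have [measurable]: "(\<lambda>\<omega>. wl_cusum w est (\<lambda>i. X i \<omega>) n) \<in> borel_measurable F"
      using IH by auto
    show ?thesis using False by simp
  qed simp
qed simp

lemma wl_cusum_time_le_iff:
  "wl_cusum_time w est X b \<omega> \<le> enat n \<longleftrightarrow>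
     (\<exists>m\<le>n. m > w \<and> wl_cusum w est (\<lambda>i. X i \<omega>) m > b)"
proof
  assume le: "wl_cusum_time w est X b \<omega> \<le> enat n"
  let ?A = "{enat n | n. n > w \<and> wl_cusum w est (\<lambda>i. X i \<omega>) n > b}"
  have "?A \<noteq> {}"
  proof
    assume "?A = {}"
    with le show False unfolding wl_cusum_time_def by (simp only: Inf_enat_def) simp
  qed
  then obtain k where "k \<in> ?A" by blast
  then have "Inf ?A \<in> ?A" by (rule wellorder_InfI)
  with le show "\<exists>m\<le>n. m > w \<and> wl_cusum w est (\<lambda>i. X i \<omega>) m > b"
    unfolding wl_cusum_time_def by auto
next
  assume "\<exists>m\<le>n. m > w \<and> wl_cusum w est (\<lambda>i. X i \<omega>) m > b"
  then obtain m where m: "m \<le> n" "m > w" "wl_cusum w est (\<lambda>i. X i \<omega>) m > b" by auto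
  then have "wl_cusum_time w est X b \<omega> \<le> enat m"
    unfolding wl_cusum_time_def by (intro Inf_lower) auto
  with m(1) show "wl_cusum_time w est X b \<omega> \<le> enat n"
    by (meson enat_ord_simps(1) order_trans)
qed

lemma stopping_time_wl_cusum_time:
  assumes est: "est \<in> borel_measurable (PiM {..<w} (\<lambda>_. borel))"
  shows "{\<omega> \<in> \<Omega>. wl_cusum_time w est X b \<omega> \<le> enat n} \<in> sets (obs_filtration \<Omega> X n)"
proof -
  let ?F = "obs_filtration \<Omega> X n"
  have "{\<omega> \<in> space ?F. wl_cusum w est (\<lambda>i. X i \<omega>) m > b} \<in> sets ?F" if "m \<le> n" for m
    by (intro borel_measurable_less borel_measurable_const measurable_wl_cusum[OF est]
          measurable_obs_filtration) (use that in auto)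
  then have "(\<Union>m\<in>{w<..n}. {\<omega> \<in> space ?F. wl_cusum w est (\<lambda>i. X i \<omega>) m > b}) \<in> sets ?F"
    by (intro sets.finite_UN) auto
  also have "(\<Union>m\<in>{w<..n}. {\<omega> \<in> space ?F. wl_cusum w est (\<lambda>i. X i \<omega>) m > b}) =
      {\<omega> \<in> \<Omega>. wl_cusum_time w est X b \<omega> \<le> enat n}"
    by (auto simp: wl_cusum_time_le_iff)
  finally show ?thesis .
qed

lemma measurable_wl_cusum_time:
  assumes est: "est \<in> borel_measurable (PiM {..<w} (\<lambda>_. borel))"
    and X: "\<And>i. 1 \<le> i \<Longrightarrow> X i \<in> borel_measurable M"
  shows "wl_cusum_time w est X b \<in> measurable M (count_space UNIV)"
proof -
  let ?T = "wl_cusum_time w est X b"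
  have le: "{\<omega> \<in> space M. ?T \<omega> \<le> enat n} \<in> sets M" for n
    using stopping_time_wl_cusum_time[OF est, of "space M" X b n]
      subalgebra_obs_filtration[of X M n] X by (auto simp: subalgebra_def)
  show ?thesis
  proof (rule measurable_count_space_eq_countable[THEN iffD2], simp, safe)
    fix t
    have fin: "{\<omega> \<in> space M. ?T \<omega> = enat n} \<in> sets M" for n
    proof -
      have "s = enat n \<longleftrightarrow> s \<le> enat n \<and> (\<forall>m<n. \<not> s \<le> enat m)" for s :: enat
      proof (cases s)
        case (enat k)
        have "k = n \<longleftrightarrow> k \<le> n \<and> (\<forall>m<n. \<not> k \<le> m)"
          by (metis leD leI le_neq_implies_less order_refl)
        then show ?thesis using enat by simp
      qed simp
      then have "{\<omega> \<in> space M. ?T \<omega> = enat n} =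
          {\<omega> \<in> space M. ?T \<omega> \<le> enat n} - (\<Union>m\<in>{..<n}. {\<omega> \<in> space M. ?T \<omega> \<le> enat m})"
        by blast
      then show ?thesis using le by (auto intro!: sets.Diff sets.finite_UN)
    qed
    have "s = \<infinity> \<longleftrightarrow> (\<forall>n. \<not> s \<le> enat n)" for s :: enat
      by (cases s) auto
    then have "{\<omega> \<in> space M. ?T \<omega> = \<infinity>} = space M - (\<Union>n. {\<omega> \<in> space M. ?T \<omega> \<le> enat n})"
      by blast
    then have inf: "{\<omega> \<in> space M. ?T \<omega> = \<infinity>} \<in> sets M"
      using le by (auto intro!: sets.Diff sets.countable_UN)
    have "?T -` {t} \<inter> space M = {\<omega> \<in> space M. ?T \<omega> = t}" by auto
    then show "?T -` {t} \<inter> space M \<in> sets M" using fin inf by (cases t) auto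
  qed auto
qed

end

(*
  False alarms.  Without a change, exp (S n) satisfies E[exp (S n); T >= n] =
  E[exp (max 0 (S (n-1))); T >= n] <= P(T >= n) + E[exp (S (n-1)); T >= n], and exp (S n) > exp b
  on T = n.  Telescoping gives sum_{k<=n} P(T >= k) >= exp b * P(T < n).

  Delay.  Fix A in F_{nu-1} and let I = |theta|^2/2.  The estimate at time n is independent of
  F_{n-w-1}, which contains {T >= n-w}; so for n >= nu+w the n-th increment has expectation
  (I - MSE/2) P(A, T >= n-w) on A and {T >= n-w}, although the windows overlap (a Wald identity
  shifted by w).  Replacing {T >= n-w} by {T >= n} costs at most I per step, and w I P(A) after
  summation.  On {T >= n} the increments sum to at most b plus the overshoot of the last one, and
  the expected overshoot of a Gaussian increment is at most I + 2.
*)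

theory Submission
  imports Defs "HOL-Real_Asymp.Real_Asymp"
begin

section \<open>Gaussian vectors\<close>

text \<open>The estimate can be any vector, arbitrarily large, the history before
  \<open>\<nu>\<close> is arbitrary, and finiteness of the mean delay is not known in advance, so
  optional stopping cannot be quoted. The overshoot is therefore bounded by \<open>I + 2\<close>
  times the probability of crossing, given the past, uniformly in the barrier and in the estimate v:
  a large v brings variance |v|^2 but also drift -|v|^2/2. Crossings at different times are disjoint
  events, hence the sum over n costs \<open>I + 2\<close> only once. All sums stop at a finite N
  with a bound free of N, so that finiteness of the delay comes out as a conclusion. Only increments
  at times from \<open>\<nu> + w\<close> on enter, because their windows lie after the change. If no
  alarm has occurred by then, the positive part of the statistic lies somewhere between 0 and b, and
  nothing more about the history is used.\<close>

lemma mvn_density_eq_prod: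
  "mvn_density m x = (\<Prod>b\<in>Basis. ennreal (normal_density (m \<bullet> b) 1 (x \<bullet> b)))"
proof -
  let ?c = "1 / sqrt (2 * pi)"
  have "(\<Prod>b\<in>Basis. normal_density (m \<bullet> b) 1 (x \<bullet> b)) =
      ?c ^ DIM(real ^ 'a) * exp (\<Sum>b\<in>Basis. - (x \<bullet> b - m \<bullet> b)\<^sup>2 / 2)"
    by (simp add: normal_density_def prod_dividef prod.distrib exp_sum power_divide)
  also have "(\<Sum>b\<in>Basis. - (x \<bullet> b - m \<bullet> b)\<^sup>2 / 2) = - (norm (x - m))\<^sup>2 / 2"
    unfolding power2_norm_eq_inner euclidean_inner[of "x - m" "x - m"]
    by (simp add: inner_diff_left
        sum_negf sum_divide_distrib[symmetric] power2_eq_square)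
  also have "?c ^ DIM(real ^ 'a) = (2 * pi) powr (- real CARD('a) / 2)"
  proof -
    have "?c = (2 * pi) powr (- 1 / 2)"
      by (simp add: powr_minus_divide powr_half_sqrt)
    then show ?thesis
      by (simp add: powr_power mult.commute)
  qed
  finally show ?thesis
    by (simp add: mvn_density_def prod_ennreal normal_density_nonneg)
qed

lemma borel_measurable_mvn_density [measurable]: "mvn_density m \<in> borel_measurable borel"
  unfolding mvn_density_def[abs_def] by measurable

definition mvn_measure :: "real ^ 'k \<Rightarrow> (real ^ 'k) measure" where
  "mvn_measure m = density lborel (mvn_density m)"

lemma sets_mvn_measure [simp, measurable_cong]: "sets (mvn_measure m) = sets borel"
  and space_mvn_measure [simp]: "space (mvn_measure m) = UNIV"
  by (simp_all add: mvn_measure_def)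

text \<open>Fubini for the product form of the density. Boxes carry what is needed later: all sides
  \<open>UNIV\<close> give total mass 1, a single restricted side gives the marginals, general sides
  give independence of the coordinates.\<close>

lemma emeasure_mvn_measure_box:
  assumes [measurable]: "\<And>b. b \<in> Basis \<Longrightarrow> A b \<in> sets borel"
  shows "emeasure (mvn_measure m) {x. \<forall>b\<in>Basis. x \<bullet> b \<in> A b} =
    (\<Prod>b\<in>Basis. emeasure (density lborel (normal_density (m \<bullet> b) 1)) (A b))"
proof -
  have ind: "indicator {x. \<forall>b\<in>Basis. x \<bullet> b \<in> A b} x =
      (\<Prod>b\<in>Basis. indicator (A b) (x \<bullet> b) :: ennreal)" for x :: "real ^ 'a"
    by (cases "\<forall>b\<in>Basis. x \<bullet> b \<in> A b")
       (auto simp: indicator_def prod_zero_iff)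
  have [measurable]: "{x :: real ^ 'a. \<forall>b\<in>Basis. x \<bullet> b \<in> A b} \<in> sets borel"
  proof -
    have "{x :: real ^ 'a. \<forall>b\<in>Basis. x \<bullet> b \<in> A b} =
        (\<Inter>b\<in>Basis. (\<lambda>x. x \<bullet> b) -` A b \<inter> space borel)"
      by auto
    also have "\<dots> \<in> sets borel"
      by (intro sets.finite_INT measurable_sets[OF _ assms]) auto
    finally show ?thesis .
  qed
  have "emeasure (mvn_measure m) {x. \<forall>b\<in>Basis. x \<bullet> b \<in> A b} =
      (\<integral>\<^sup>+x. (\<Prod>b\<in>Basis. ennreal (normal_density (m \<bullet> b) 1 (x \<bullet> b)) *
          indicator (A b) (x \<bullet> b)) \<partial>lborel)"
    by (simp add: mvn_measure_def emeasure_density ind mvn_density_eq_prod prod.distrib)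
  also have "\<dots> = (\<Prod>b\<in>Basis. \<integral>\<^sup>+y. ennreal (normal_density (m \<bullet> b) 1 y) *
      indicator (A b) y \<partial>lborel)"
    by (rule nn_integral_lborel_prod) auto
  also have "\<dots> = (\<Prod>b\<in>Basis. emeasure (density lborel (normal_density (m \<bullet> b) 1)) (A b))"
    by (intro prod.cong refl) (simp add: emeasure_density)
  finally show ?thesis .
qed

lemma prob_space_mvn_measure: "prob_space (mvn_measure m)"
proof
  have "emeasure (density lborel (normal_density (m \<bullet> b) 1)) UNIV = 1" for b
    using prob_space.emeasure_space_1[OF prob_space_normal_density[of 1 "m \<bullet> b"]] by simp
  then show "emeasure (mvn_measure m) (space (mvn_measure m)) = 1"
    using emeasure_mvn_measure_box[of "\<lambda>_. UNIV" m] by simp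
qed

interpretation mvn: prob_space "mvn_measure m" for m
  by (rule prob_space_mvn_measure)

lemma emeasure_mvn_measure_coordinate:
  assumes "b \<in> Basis" and [measurable]: "A \<in> sets borel"
  shows "emeasure (mvn_measure m) {x. x \<bullet> b \<in> A} =
    emeasure (density lborel (normal_density (m \<bullet> b) 1)) A"
proof -
  have 1: "emeasure (density lborel (normal_density (m \<bullet> b) 1)) UNIV = 1" for b
    using prob_space.emeasure_space_1[OF prob_space_normal_density[of 1 "m \<bullet> b"]] by simp
  let ?A = "\<lambda>i. if i = b then A else UNIV"
  have "emeasure (mvn_measure m) {x. x \<bullet> b \<in> A} =
      emeasure (mvn_measure m) {x. \<forall>i\<in>Basis. x \<bullet> i \<in> ?A i}"
    using assms by (intro arg_cong2[where f=emeasure]) auto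
  also have "\<dots> = (\<Prod>i\<in>Basis. emeasure (density lborel (normal_density (m \<bullet> i) 1)) (?A i))"
    by (rule emeasure_mvn_measure_box) auto
  also have "\<dots> = (\<Prod>i\<in>{b}. emeasure (density lborel (normal_density (m \<bullet> i) 1)) (?A i))"
    using assms(1) by (intro prod.mono_neutral_right) (auto simp: 1)
  finally show ?thesis by simp
qed

lemma distributed_mvn_measure_coordinate:
  assumes "b \<in> Basis"
  shows "distributed (mvn_measure m) lborel (\<lambda>x. x \<bullet> b) (normal_density (m \<bullet> b) 1)"
  unfolding distributed_def
proof safe
  show "distr (mvn_measure m) lborel (\<lambda>x. x \<bullet> b) = density lborel (normal_density (m \<bullet> b) 1)"
  proof (rule measure_eqI)
    fix A assume "A \<in> sets (distr (mvn_measure m) lborel (\<lambda>x. x \<bullet> b))"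
    then have [measurable]: "A \<in> sets borel" by simp
    show "emeasure (distr (mvn_measure m) lborel (\<lambda>x. x \<bullet> b)) A =
        emeasure (density lborel (normal_density (m \<bullet> b) 1)) A"
      by (simp add: emeasure_distr vimage_def emeasure_mvn_measure_coordinate[OF assms])
  qed simp
qed auto

lemma indep_vars_mvn_measure_coordinates:
  "prob_space.indep_vars (mvn_measure m) (\<lambda>_. borel) (\<lambda>b x. x \<bullet> b) Basis"
proof (subst mvn.indep_vars_finite[where E="\<lambda>_. sets borel"])
  show "\<forall>A\<in>(\<Pi> i\<in>Basis. sets borel).
    mvn.prob m (\<Inter>j\<in>Basis. (\<lambda>x. x \<bullet> j) -` A j \<inter> space (mvn_measure m)) =
    (\<Prod>j\<in>Basis. mvn.prob m ((\<lambda>x. x \<bullet> j) -` A j \<inter> space (mvn_measure m)))"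
  proof
    fix A :: "real ^ 'a \<Rightarrow> real set" assume A: "A \<in> (\<Pi> i\<in>Basis. sets borel)"
    have "emeasure (mvn_measure m) (\<Inter>j\<in>Basis. (\<lambda>x. x \<bullet> j) -` A j \<inter> space (mvn_measure m)) =
        emeasure (mvn_measure m) {x. \<forall>b\<in>Basis. x \<bullet> b \<in> A b}"
      by (intro arg_cong2[where f=emeasure]) auto
    also have "\<dots> = (\<Prod>b\<in>Basis. emeasure (density lborel (normal_density (m \<bullet> b) 1)) (A b))"
      using A by (intro emeasure_mvn_measure_box) auto
    also have "\<dots> = (\<Prod>b\<in>Basis. emeasure (mvn_measure m) {x. x \<bullet> b \<in> A b})"
      using A by (intro prod.cong refl emeasure_mvn_measure_coordinate[symmetric]) auto
    finally show "mvn.prob m (\<Inter>j\<in>Basis. (\<lambda>x. x \<bullet> j) -` A j \<inter> space (mvn_measure m)) =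
        (\<Prod>j\<in>Basis. mvn.prob m ((\<lambda>x. x \<bullet> j) -` A j \<inter> space (mvn_measure m)))"
      by (simp add: mvn.emeasure_eq_measure prod_ennreal vimage_def prod_nonneg)
  qed
qed (auto simp: Int_stable_def sets.sigma_sets_eq[of borel, simplified])

section \<open>Linear functionals and likelihood ratios of a Gaussian vector\<close>

lemma distributed_mvn_measure_inner:
  assumes "v \<noteq> 0"
  shows "distributed (mvn_measure m) lborel (\<lambda>x. v \<bullet> x) (normal_density (v \<bullet> m) (norm v))"
proof -
  \<comment> \<open>Coordinates with \<open>v \<bullet> b = 0\<close> are dropped, since their terms
    would be normal with variance 0 and have no density.\<close>
  let ?B = "{b \<in> Basis. v \<bullet> b \<noteq> 0}"
  have ne: "?B \<noteq> {}" using assms euclidean_all_zero_iff[of v] by auto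
  have *: "distributed (mvn_measure m) lborel (\<lambda>x. \<Sum>b\<in>?B. (v \<bullet> b) * (x \<bullet> b))
     (normal_density (\<Sum>b\<in>?B. (v \<bullet> b) * (m \<bullet> b)) (sqrt (\<Sum>b\<in>?B. \<bar>v \<bullet> b\<bar>\<^sup>2)))"
  proof (rule mvn.sum_indep_normal[OF _ ne])
    show "mvn.indep_vars m (\<lambda>_. borel) (\<lambda>b x. (v \<bullet> b) * (x \<bullet> b)) ?B"
      by (rule mvn.indep_vars_compose2[OF mvn.indep_vars_subset[OF
            indep_vars_mvn_measure_coordinates]]) auto
    fix b assume b: "b \<in> ?B"
    show "distributed (mvn_measure m) lborel (\<lambda>x. (v \<bullet> b) * (x \<bullet> b))
        (normal_density ((v \<bullet> b) * (m \<bullet> b)) \<bar>v \<bullet> b\<bar>)"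
      using mvn.normal_density_affine[OF distributed_mvn_measure_coordinate, where \<alpha>="v \<bullet> b" and \<beta>=0] b
      by auto
  qed auto
  have sum: "(\<Sum>b\<in>?B. (v \<bullet> b) * (x \<bullet> b)) = v \<bullet> x" for x
    unfolding euclidean_inner[of v x] by (rule sum.mono_neutral_left) auto
  have "(\<Sum>b\<in>?B. \<bar>v \<bullet> b\<bar>\<^sup>2) = v \<bullet> v"
    using sum[of v] by (simp add: power2_eq_square)
  then show ?thesis using * unfolding sum by (simp add: norm_eq_sqrt_inner)
qed

lemma
  shows integrable_mvn_measure_inner: "integrable (mvn_measure m) (\<lambda>x. v \<bullet> x)"
    and integral_mvn_measure_inner: "(\<integral>x. v \<bullet> x \<partial>mvn_measure m) = v \<bullet> m"
proof -
  have "integrable (mvn_measure m) (\<lambda>x. v \<bullet> x) \<and> (\<integral>x. v \<bullet> x \<partial>mvn_measure m) = v \<bullet> m"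
  proof (cases "v = 0")
    case False
    note d = distributed_mvn_measure_inner[OF False, of m]
    show ?thesis
      using distributed_integrable[OF d, of "\<lambda>x. x"] distributed_integral[OF d, of "\<lambda>x. x"]
        integrable_normal_moment_nz_1[of "norm v" "v \<bullet> m"]
        integral_normal_moment_nz_1[of "norm v" "v \<bullet> m"] False
      by simp
  qed simp
  then show "integrable (mvn_measure m) (\<lambda>x. v \<bullet> x)" "(\<integral>x. v \<bullet> x \<partial>mvn_measure m) = v \<bullet> m"
    by auto
qed

text \<open>Completing the square turns the integrand times \<open>mvn_density 0\<close> into
  \<open>mvn_density v\<close>, which has total mass 1. Because this holds for every
  \<open>v\<close>, the false alarm bound does not depend on the quality of the estimator.\<close>

lemma nn_integral_mvn_likelihood_ratio:
  "(\<integral>\<^sup>+x. ennreal (exp (v \<bullet> x - (norm v)\<^sup>2 / 2)) \<partial>mvn_measure 0) = 1"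
proof -
  have *: "mvn_density 0 x * ennreal (exp (v \<bullet> x - (norm v)\<^sup>2 / 2)) = mvn_density v x" for x
  proof -
    have "- (norm x)\<^sup>2 / 2 + (v \<bullet> x - (norm v)\<^sup>2 / 2) = - (norm (x - v))\<^sup>2 / 2"
      by (simp add: power2_norm_eq_inner inner_diff_left inner_diff_right inner_commute field_simps)
    then have "exp (- (norm x)\<^sup>2 / 2) * exp (v \<bullet> x - (norm v)\<^sup>2 / 2) = exp (- (norm (x - v))\<^sup>2 / 2)"
      by (metis exp_add)
    then show ?thesis
      by (simp add: mvn_density_def ennreal_mult'[symmetric] mult.assoc)
  qed
  have "(\<integral>\<^sup>+x. ennreal (exp (v \<bullet> x - (norm v)\<^sup>2 / 2)) \<partial>mvn_measure 0) =
      (\<integral>\<^sup>+x. mvn_density v x \<partial>lborel)"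
    unfolding mvn_measure_def by (subst nn_integral_density) (simp_all add: *)
  also have "\<dots> = emeasure (mvn_measure v) (space (mvn_measure v))"
    unfolding mvn_measure_def by (subst emeasure_density) auto
  finally show ?thesis using mvn.emeasure_space_1[of v] by simp
qed

section \<open>Overshoot of a normal variable over a level\<close>

lemma normal_stein_truncated:
  fixes m \<sigma> c :: real
  assumes \<sigma>: "\<sigma> > 0"
  shows "set_integrable lborel {c<..} (\<lambda>x. normal_density m \<sigma> x * ((x - c) * (x - m)))"
    and "(LINT x:{c<..}|lborel. normal_density m \<sigma> x * ((x - c) * (x - m))) =
      \<sigma>\<^sup>2 * (LINT x:{c<..}|lborel. normal_density m \<sigma> x)"
proof -
  let ?\<phi> = "normal_density m \<sigma>"
  \<comment> \<open>(x - c)(x - m) = (x - m)^2 + (m - c)(x - m) is a combination of central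
    moments.\<close>
  have "integrable lborel (\<lambda>x. ?\<phi> x * (x - m)^2 + (m - c) * (?\<phi> x * (x - m)^1))"
    by (intro Bochner_Integration.integrable_add integrable_mult_right integrable_normal_moment \<sigma>)
  then have i1: "integrable lborel (\<lambda>x. ?\<phi> x * ((x - c) * (x - m)))"
    by (rule Bochner_Integration.integrable_cong[THEN iffD1, rotated 2])
       (auto simp: algebra_simps power2_eq_square)
  have i2: "integrable lborel ?\<phi>" using \<sigma> by simp
  show s1: "set_integrable lborel {c<..} (\<lambda>x. ?\<phi> x * ((x - c) * (x - m)))"
    unfolding set_integrable_def using integrable_mult_indicator[OF _ i1, of "{c<..}"] by simp
  have s2: "set_integrable lborel {c<..} (\<lambda>x. \<sigma>\<^sup>2 * ?\<phi> x)"
    unfolding set_integrable_def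
    using integrable_mult_indicator[OF _ integrable_mult_right[OF i2], of "{c<..}" "\<sigma>\<^sup>2"] by simp
  let ?f = "\<lambda>x. ?\<phi> x * ((x - c) * (x - m)) - \<sigma>\<^sup>2 * ?\<phi> x"
  \<comment> \<open>An antiderivative of \<open>?f\<close>, because the density has derivative -(x -
    m)/\<sigma>^2 times itself. It vanishes at \<open>c\<close> through the factor x - c and at
    \<infinity> through Gaussian decay, which gives the identity.\<close>
  let ?F = "\<lambda>x. - \<sigma>\<^sup>2 * (x - c) * ?\<phi> x"
  have ein: "einterval (ereal c) \<infinity> = {c<..}" by (auto simp: einterval_def)
  have "(LBINT x=ereal c..\<infinity>. ?f x) = 0 - 0"
  proof (rule interval_integral_FTC_integrable)
    fix x :: real
    have "(?\<phi> has_real_derivative - (x - m) / \<sigma>\<^sup>2 * ?\<phi> x) (at x)"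
    proof -
      have *: "?\<phi> = (\<lambda>x. 1 / sqrt (2 * pi * \<sigma>\<^sup>2) * exp (- (x - m)\<^sup>2 / (2 * \<sigma>\<^sup>2)))"
        by (simp add: normal_density_def fun_eq_iff)
      have "((\<lambda>x. exp (- (x - m)\<^sup>2 / (2 * \<sigma>\<^sup>2))) has_real_derivative
          exp (- (x - m)\<^sup>2 / (2 * \<sigma>\<^sup>2)) * (- (x - m) / \<sigma>\<^sup>2)) (at x)"
        using \<sigma> by (auto intro!: derivative_eq_intros simp: field_simps)
      from DERIV_cmult[OF this, of "1 / sqrt (2 * pi * \<sigma>\<^sup>2)"] show ?thesis
        unfolding * by (simp add: mult_ac)
    qed
    then have "(?F has_real_derivative ?f x) (at x)"
      using \<sigma> by (auto intro!: derivative_eq_intros simp: field_simps power2_eq_square)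
    then show "(?F has_vector_derivative ?f x) (at x)"
      by (simp add: has_real_derivative_iff_has_vector_derivative)
    show "isCont ?f x"
      unfolding normal_density_def using \<sigma> by (intro continuous_intros) auto
  next
    show "set_integrable lborel (einterval (ereal c) \<infinity>) ?f"
      unfolding ein by (rule set_integral_diff(1)[OF s1 s2])
    have "(?F \<longlongrightarrow> ?F c) (at_right c)"
      unfolding normal_density_def using \<sigma> by (intro tendsto_intros) auto
    then show "((?F \<circ> real_of_ereal) \<longlongrightarrow> 0) (at_right (ereal c))"
      by (simp add: ereal_tendsto_simps)
    have "((\<lambda>x. - \<sigma>\<^sup>2 * (x - c) * (1 / sqrt (2 * pi * \<sigma>\<^sup>2) * exp (- (x - m)\<^sup>2 / (2 * \<sigma>\<^sup>2)))) \<longlongrightarrow> 0) at_top"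
      using \<sigma> by real_asymp
    then have "(?F \<longlongrightarrow> 0) at_top" by (simp add: normal_density_def)
    then show "((?F \<circ> real_of_ereal) \<longlongrightarrow> 0) (at_left \<infinity>)"
      by (simp add: ereal_tendsto_simps)
  qed simp
  then have "(LINT x:{c<..}|lborel. ?f x) = 0"
    by (simp add: interval_lebesgue_integral_def ein)
  then show "(LINT x:{c<..}|lborel. ?\<phi> x * ((x - c) * (x - m))) =
      \<sigma>\<^sup>2 * (LINT x:{c<..}|lborel. ?\<phi> x)"
    using set_integral_diff(2)[OF s1 s2] by simp
qed

text \<open>Origin of the constant I + 2. In the worst case \<open>c = 0\<close> with v and \<theta>
  parallel, the claim is a quadratic inequality in |v|, and for L > 0 its discriminant is
  nonpositive exactly when L is at least |\<theta>|^2/2 + 2. For this L the difference of the two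
  sides is the square (|\<theta>||v|/2 - L)^2.\<close>

lemma overshoot_constant:
  fixes v \<theta> :: "'b :: real_inner"
  assumes "c \<ge> 0"
  defines "L \<equiv> (norm \<theta>)\<^sup>2 / 2 + 2"
  shows "(norm v)\<^sup>2 + L\<^sup>2 \<le> L * (2 * L + ((norm v)\<^sup>2 / 2 + c) - v \<bullet> \<theta>)"
proof -
  have L: "L \<ge> 0" by (simp add: L_def)
  have "0 \<le> (norm \<theta> * norm v / 2 - L)\<^sup>2" by simp
  also have "\<dots> = (norm \<theta>)\<^sup>2 * (norm v)\<^sup>2 / 4 - L * (norm v * norm \<theta>) + L\<^sup>2"
    by (simp add: power2_eq_square algebra_simps)
  also have "(norm \<theta>)\<^sup>2 * (norm v)\<^sup>2 / 4 = (norm v)\<^sup>2 * (L / 2 - 1)"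
    by (simp add: L_def algebra_simps)
  finally have 1: "0 \<le> (norm v)\<^sup>2 * (L / 2 - 1) - L * (norm v * norm \<theta>) + L\<^sup>2" .
  have 2: "L * (v \<bullet> \<theta>) \<le> L * (norm v * norm \<theta>)"
    by (intro mult_left_mono norm_cauchy_schwarz L)
  have 3: "0 \<le> L * c" using L assms(1) by simp
  from 1 2 3 show ?thesis by (simp add: algebra_simps power2_eq_square)
qed

text \<open>Stein's identity for \<open>U = (Y - k)\<^sup>+\<close> with \<open>Y\<close> normal of mean \<open>m\<close> and variance \<open>\<sigma>\<^sup>2\<close> reads
  \<open>E U\<^sup>2 + (k - m) E U = \<sigma>\<^sup>2 P(Y > k)\<close>; bounding \<open>U\<^sup>2 \<ge> 2 L U - L\<^sup>2\<close> on \<open>Y > k\<close> turns it into a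
  bound for \<open>E U\<close>.\<close>

lemma normal_overshoot:
  fixes m \<sigma> k L :: real
  assumes \<sigma>: "\<sigma> > 0" and L: "L > 0" and *: "\<sigma>\<^sup>2 + L\<^sup>2 \<le> L * (2 * L + k - m)"
  shows "(\<integral>\<^sup>+y. ennreal (normal_density m \<sigma> y) * ennreal (y - k) \<partial>lborel) \<le>
    ennreal L * (\<integral>\<^sup>+y. ennreal (normal_density m \<sigma> y) * indicator {k<..} y \<partial>lborel)"
proof -
  let ?\<phi> = "normal_density m \<sigma>"
  have i0: "integrable lborel ?\<phi>" using \<sigma> by simp
  have "integrable lborel (\<lambda>x. ?\<phi> x * x - k * ?\<phi> x)"
    by (intro Bochner_Integration.integrable_diff integrable_mult_right
         integrable_normal_moment_nz_1 \<sigma> i0)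
  then have i1: "integrable lborel (\<lambda>x. ?\<phi> x * (x - k))"
    by (rule Bochner_Integration.integrable_cong[THEN iffD1, rotated 2]) (auto simp: algebra_simps)
  have s0: "set_integrable lborel {k<..} ?\<phi>"
    unfolding set_integrable_def using integrable_mult_indicator[OF _ i0, of "{k<..}"] by simp
  have s1: "set_integrable lborel {k<..} (\<lambda>x. ?\<phi> x * (x - k))"
    unfolding set_integrable_def using integrable_mult_indicator[OF _ i1, of "{k<..}"] by simp
  define p where "p = (LINT x:{k<..}|lborel. ?\<phi> x)"
  define u where "u = (LINT x:{k<..}|lborel. ?\<phi> x * (x - k))"
  have "(2 * L + k - m) * u - L\<^sup>2 * p =
      (LINT x:{k<..}|lborel. (2 * L + k - m) * (?\<phi> x * (x - k)) - L\<^sup>2 * ?\<phi> x)"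
    unfolding u_def p_def using s0 s1 by (subst set_integral_diff) auto
  also have "\<dots> \<le> (LINT x:{k<..}|lborel. ?\<phi> x * ((x - k) * (x - m)))"
  proof (rule set_integral_mono)
    show "set_integrable lborel {k<..} (\<lambda>x. (2 * L + k - m) * (?\<phi> x * (x - k)) - L\<^sup>2 * ?\<phi> x)"
      using s0 s1 by (intro set_integral_diff set_integrable_mult_right) auto
    show "set_integrable lborel {k<..} (\<lambda>x. ?\<phi> x * ((x - k) * (x - m)))"
      by (rule normal_stein_truncated(1)[OF \<sigma>])
    fix x
    have "0 \<le> ?\<phi> x * (x - k - L)\<^sup>2" by simp
    then show "(2 * L + k - m) * (?\<phi> x * (x - k)) - L\<^sup>2 * ?\<phi> x \<le> ?\<phi> x * ((x - k) * (x - m))"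
      by (simp add: algebra_simps power2_eq_square)
  qed
  also have "\<dots> = \<sigma>\<^sup>2 * p"
    unfolding p_def by (rule normal_stein_truncated(2)[OF \<sigma>])
  finally have "(2 * L + k - m) * u \<le> (\<sigma>\<^sup>2 + L\<^sup>2) * p" by (simp add: algebra_simps)
  also have "\<dots> \<le> L * (2 * L + k - m) * p"
  proof (rule mult_right_mono[OF *])
    show "0 \<le> p" unfolding p_def set_lebesgue_integral_def
      by (intro integral_nonneg_AE) (auto simp: indicator_def)
  qed
  finally have "(2 * L + k - m) * u \<le> (2 * L + k - m) * (L * p)" by (simp add: mult_ac)
  moreover have "2 * L + k - m > 0"
  proof -
    have "0 < \<sigma>\<^sup>2 + L\<^sup>2" using \<sigma> by (simp add: add_pos_nonneg)
    then have "0 < L * (2 * L + k - m)" using * by linarith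
    then show ?thesis using L by (simp add: zero_less_mult_iff)
  qed
  ultimately have up: "u \<le> L * p" by simp
  \<comment> \<open>\<open>ennreal\<close> sends negative numbers to 0, so
    \<open>ennreal (y - k)\<close> is already the positive part.\<close>
  have "(\<integral>\<^sup>+y. ennreal (?\<phi> y) * ennreal (y - k) \<partial>lborel) =
      (\<integral>\<^sup>+y. ennreal (indicator {k<..} y *\<^sub>R (?\<phi> y * (y - k))) \<partial>lborel)"
    by (intro nn_integral_cong) (auto simp: indicator_def ennreal_mult'[symmetric] ennreal_neg mult_nonneg_nonpos)
  also have "\<dots> = ennreal u"
    unfolding u_def set_lebesgue_integral_def
    using s1 by (intro nn_integral_eq_integral) (auto simp: set_integrable_def indicator_def)
  finally have 1: "(\<integral>\<^sup>+y. ennreal (?\<phi> y) * ennreal (y - k) \<partial>lborel) = ennreal u" .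
  have "(\<integral>\<^sup>+y. ennreal (?\<phi> y) * indicator {k<..} y \<partial>lborel) =
      (\<integral>\<^sup>+y. ennreal (indicator {k<..} y *\<^sub>R ?\<phi> y) \<partial>lborel)"
    by (intro nn_integral_cong) (auto simp: indicator_def)
  also have "\<dots> = ennreal p"
    unfolding p_def set_lebesgue_integral_def
    using s0 by (intro nn_integral_eq_integral) (auto simp: set_integrable_def indicator_def)
  finally have 2: "(\<integral>\<^sup>+y. ennreal (?\<phi> y) * indicator {k<..} y \<partial>lborel) = ennreal p" .
  show ?thesis unfolding 1 2 using up L by (simp add: ennreal_mult'[symmetric] ennreal_leI)
qed

text \<open>The barrier is absorbed into the level \<open>k\<close>, which leaves the normal
  variable \<open>v \<bullet> x\<close>. For \<open>v = 0\<close> that variable has no density, but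
  then nothing lies above a barrier \<open>c \<ge> 0\<close>.\<close>

lemma mvn_measure_overshoot:
  assumes "c \<ge> 0"
  shows "(\<integral>\<^sup>+x. ennreal (v \<bullet> x - (norm v)\<^sup>2 / 2 - c) \<partial>mvn_measure \<theta>) \<le>
    (\<integral>\<^sup>+x. ennreal ((norm \<theta>)\<^sup>2 / 2 + 2) *
        indicator {x. v \<bullet> x - (norm v)\<^sup>2 / 2 > c} x \<partial>mvn_measure \<theta>)"
proof (cases "v = 0")
  case True
  then show ?thesis using assms by (simp add: ennreal_neg)
next
  case False
  define k where "k = (norm v)\<^sup>2 / 2 + c"
  note d = distributed_mvn_measure_inner[OF False, of \<theta>]
  have "(\<integral>\<^sup>+x. ennreal (v \<bullet> x - (norm v)\<^sup>2 / 2 - c) \<partial>mvn_measure \<theta>) =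
      (\<integral>\<^sup>+x. ennreal (v \<bullet> x - k) \<partial>mvn_measure \<theta>)"
    by (simp add: k_def algebra_simps)
  also have "\<dots> = (\<integral>\<^sup>+y. ennreal (normal_density (v \<bullet> \<theta>) (norm v) y) * ennreal (y - k) \<partial>lborel)"
    by (rule distributed_nn_integral[OF d, symmetric]) simp
  also have "\<dots> \<le> ennreal ((norm \<theta>)\<^sup>2 / 2 + 2) *
      (\<integral>\<^sup>+y. ennreal (normal_density (v \<bullet> \<theta>) (norm v) y) * indicator {k<..} y \<partial>lborel)"
    using overshoot_constant[OF assms, of v \<theta>] False
    by (intro normal_overshoot) (auto simp: k_def add_nonneg_pos)
  also have "(\<integral>\<^sup>+y. ennreal (normal_density (v \<bullet> \<theta>) (norm v) y) * indicator {k<..} y \<partial>lborel) =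
      (\<integral>\<^sup>+x. indicator {k<..} (v \<bullet> x) \<partial>mvn_measure \<theta>)"
    by (rule distributed_nn_integral[OF d]) simp
  also have "ennreal ((norm \<theta>)\<^sup>2 / 2 + 2) * \<dots> =
      (\<integral>\<^sup>+x. ennreal ((norm \<theta>)\<^sup>2 / 2 + 2) * indicator {k<..} (v \<bullet> x) \<partial>mvn_measure \<theta>)"
    by (rule nn_integral_cmult[symmetric]) simp
  also have "\<dots> = (\<integral>\<^sup>+x. ennreal ((norm \<theta>)\<^sup>2 / 2 + 2) *
        indicator {x. v \<bullet> x - (norm v)\<^sup>2 / 2 > c} x \<partial>mvn_measure \<theta>)"
    by (intro nn_integral_cong) (auto simp: indicator_def k_def)
  finally show ?thesis .
qed

section \<open>Past and future of the observations\<close>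

text \<open>Arbitrary sets of times are allowed because the window of an estimate is a block that
  need not start at 1, and a fresh observation is a singleton.\<close>

definition obs_sigma :: "'a set \<Rightarrow> (nat \<Rightarrow> 'a \<Rightarrow> real ^ 'k) \<Rightarrow> nat set \<Rightarrow> 'a measure" where
  "obs_sigma \<Omega> X K = sigma \<Omega> (\<Union>i\<in>K. {X i -` A \<inter> \<Omega> | A. A \<in> sets borel})"

lemma obs_filtration_eq_obs_sigma: "obs_filtration \<Omega> X n = obs_sigma \<Omega> X {1..n}"
  by (simp add: obs_filtration_def obs_sigma_def)

lemma space_obs_sigma [simp]: "space (obs_sigma \<Omega> X K) = \<Omega>"
  unfolding obs_sigma_def by (rule space_measure_of) auto

lemma sets_obs_sigma:
  "sets (obs_sigma \<Omega> X K) = sigma_sets \<Omega> (\<Union>i\<in>K. {X i -` A \<inter> \<Omega> | A. A \<in> sets borel})"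
  unfolding obs_sigma_def by (rule sets_measure_of) auto

lemma measurable_obs_sigma:
  fixes X :: "nat \<Rightarrow> 'a \<Rightarrow> real ^ 'k"
  assumes "i \<in> K"
  shows "X i \<in> borel_measurable (obs_sigma \<Omega> X K)"
proof (rule measurableI)
  fix A :: "(real ^ 'k) set" assume "A \<in> sets borel"
  then have "X i -` A \<inter> \<Omega> \<in> (\<Union>i\<in>K. {X i -` A \<inter> \<Omega> | A. A \<in> sets borel})"
    using assms by auto
  then show "X i -` A \<inter> space (obs_sigma \<Omega> X K) \<in> sets (obs_sigma \<Omega> X K)"
    unfolding sets_obs_sigma space_obs_sigma by (rule sigma_sets.Basic)
qed simp

text \<open>Serves to shift a window at times m + 1 to m + w onto \<open>{..<w}\<close>, the index
  set of the arguments of \<open>est\<close>.\<close>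

lemma (in prob_space) indep_vars_reindex:
  assumes f: "inj_on f I" and X: "indep_vars N X (f ` I)"
  shows "indep_vars (\<lambda>i. N (f i)) (\<lambda>i. X (f i)) I"
  unfolding indep_vars_def2
proof (intro conjI ballI indep_setsI)
  let ?E = "\<lambda>i. {X i -` A \<inter> space M |A. A \<in> sets (N i)}"
  have E: "indep_sets ?E (f ` I)" and rv: "\<And>i. i \<in> I \<Longrightarrow> X (f i) \<in> measurable M (N (f i))"
    using X unfolding indep_vars_def2 by blast+
  show "X (f i) \<in> measurable M (N (f i))" if "i \<in> I" for i by (rule rv[OF that])
  show "?E (f i) \<subseteq> events" if "i \<in> I" for i
    using measurable_sets[OF rv[OF that]] by auto
  fix A J assume J: "J \<noteq> {}" "J \<subseteq> I" "finite J" and A: "\<forall>j\<in>J. A j \<in> ?E (f j)"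
  have inj: "inj_on f J" using f J(2) by (rule inj_on_subset)
  let ?A = "\<lambda>k. A (inv_into J f k)"
  have "prob (\<Inter>k\<in>f ` J. ?A k) = (\<Prod>k\<in>f ` J. prob (?A k))"
  proof (rule indep_setsD[OF E])
    show "\<forall>k\<in>f ` J. ?A k \<in> ?E k"
    proof
      fix k assume "k \<in> f ` J"
      then obtain j where j: "j \<in> J" "k = f j" by auto
      show "?A k \<in> ?E k" unfolding j(2) inv_into_f_f[OF inj j(1)] using A j(1) by blast
    qed
  qed (use J in auto)
  moreover have "(\<Inter>k\<in>f ` J. ?A k) = (\<Inter>j\<in>J. A j)"
    using inv_into_f_f[OF inj] by simp
  moreover have "(\<Prod>k\<in>f ` J. prob (?A k)) = (\<Prod>j\<in>J. prob (A j))"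
    unfolding prod.reindex[OF inj] by (intro prod.cong) (simp_all add: inv_into_f_f[OF inj])
  ultimately show "prob (\<Inter>j\<in>J. A j) = (\<Prod>j\<in>J. prob (A j))" by simp
qed

text \<open>The means are left arbitrary so that the law without change and every law with a change
  are instances.\<close>

locale gaussian_obs = prob_space M for M :: "'a measure" +
  fixes X :: "nat \<Rightarrow> 'a \<Rightarrow> real ^ 'k" and \<mu> :: "nat \<Rightarrow> real ^ 'k"
  assumes indep_obs: "indep_vars (\<lambda>_. borel) X {1..}"
    and distributed_obs: "\<And>n. n \<ge> 1 \<Longrightarrow> distributed M lborel (X n) (mvn_density (\<mu> n))"
begin

abbreviation F :: "nat \<Rightarrow> 'a measure" where
  "F \<equiv> obs_filtration (space M) X"

lemma measurable_obs: "n \<ge> 1 \<Longrightarrow> X n \<in> borel_measurable M"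
  using distributed_measurable[OF distributed_obs] by simp

lemma distr_obs: "n \<ge> 1 \<Longrightarrow> distr M borel (X n) = mvn_measure (\<mu> n)"
  using distributed_distr_eq_density[OF distributed_obs, of n]
  by (simp add: mvn_measure_def cong: distr_cong)

lemma subalgebra_F: "subalgebra M (F n)"
  by (rule subalgebra_obs_filtration) (rule measurable_obs)

lemma subalgebra_obs_sigma:
  assumes "K \<subseteq> {1..}"
  shows "subalgebra M (obs_sigma (space M) X K)"
proof -
  have "(\<Union>i\<in>K. {X i -` A \<inter> space M | A. A \<in> sets borel}) \<subseteq> sets M"
  proof safe
    fix i and A :: "(real ^ 'k) set" assume "i \<in> K" "A \<in> sets borel"
    then show "X i -` A \<inter> space M \<in> events"
      using measurable_sets[OF measurable_obs[of i]] assms by auto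
  qed
  then show ?thesis
    unfolding subalgebra_def sets_obs_sigma by (simp add: sets.sigma_sets_subset)
qed

lemma F_sets: "A \<in> sets (F n) \<Longrightarrow> A \<in> sets M"
  using subalgebra_F[of n] unfolding subalgebra_def by blast

lemma F_mono: "A \<in> sets (F m) \<Longrightarrow> m \<le> n \<Longrightarrow> A \<in> sets (F n)"
  using obs_filtration_mono[of m n "space M" X] by blast

lemma F_measurable: "f \<in> measurable (F n) N \<Longrightarrow> f \<in> measurable M N"
  by (rule measurable_from_subalg[OF subalgebra_F])

text \<open>Disjoint blocks of times generate independent sigma-algebras because the preimages of
  Borel sets under one observation are closed under intersection; \<open>case_bool\<close> presents
  the two blocks as a family over the booleans.\<close>

lemma indep_set_past_future:
  assumes K: "K \<subseteq> {m<..}"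
  shows "indep_set (sets (F m)) (sets (obs_sigma (space M) X K))"
proof -
  let ?E = "\<lambda>i. {X i -` A \<inter> space M | A. A \<in> sets borel}"
  have "indep_sets (\<lambda>j. sigma_sets (space M) (\<Union>i\<in>case_bool {1..m} K j. ?E i)) UNIV"
  proof (rule indep_sets_collect_sigma)
    show "indep_sets ?E (\<Union>j\<in>UNIV. case_bool {1..m} K j)"
    proof (rule indep_sets_mono_index)
      show "indep_sets ?E {1..}" using indep_obs unfolding indep_vars_def2 by simp
      show "(\<Union>j\<in>UNIV. case_bool {1..m} K j) \<subseteq> {1..}"
        using K by (auto split: bool.splits)
    qed
    show "disjoint_family_on (case_bool {1..m} K) UNIV"
      using K by (auto simp: disjoint_family_on_def split: bool.splits)
    show "Int_stable (?E i)" for i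
    proof (rule Int_stableI, safe)
      fix A B :: "(real ^ 'k) set" assume "A \<in> sets borel" "B \<in> sets borel"
      then show "\<exists>C. X i -` A \<inter> space M \<inter> (X i -` B \<inter> space M) = X i -` C \<inter> space M \<and> C \<in> sets borel"
        by (intro exI[of _ "A \<inter> B"]) auto
    qed
  qed
  then show ?thesis
    unfolding indep_set_def
    by (rule indep_sets_mono_sets)
       (auto simp: obs_filtration_eq_obs_sigma sets_obs_sigma split: bool.splits)
qed

lemma indep_var_past_future:
  assumes K: "K \<subseteq> {m<..}" and Y: "Y \<in> measurable (obs_sigma (space M) X K) N"
    and Z: "Z \<in> measurable (F m) N'"
  shows "indep_var N' Z N Y"
proof -
  have sub: "subalgebra M (obs_sigma (space M) X K)"
    using K by (intro subalgebra_obs_sigma) auto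
  show ?thesis
    unfolding indep_var_eq
  proof (intro conjI)
    show "Z \<in> measurable M N'" using Z by (rule F_measurable)
    show "Y \<in> measurable M N" by (rule measurable_from_subalg[OF sub Y])
    have "sigma_sets (space M) {Z -` A \<inter> space M |A. A \<in> sets N'} \<subseteq> sets (F m)"
      using measurable_sets[OF Z]
        sets.sigma_sets_subset[of "{Z -` A \<inter> space M |A. A \<in> sets N'}" "F m"] by auto
    moreover have "sigma_sets (space M) {Y -` A \<inter> space M |A. A \<in> sets N} \<subseteq>
        sets (obs_sigma (space M) X K)"
      using measurable_sets[OF Y] sets.sigma_sets_subset[of "{Y -` A \<inter> space M |A. A \<in> sets N}"
          "obs_sigma (space M) X K"] by auto
    ultimately have sub': "case_bool (sigma_sets (space M) {Z -` A \<inter> space M |A. A \<in> sets N'})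
          (sigma_sets (space M) {Y -` A \<inter> space M |A. A \<in> sets N}) i \<subseteq>
        case_bool (sets (F m)) (sets (obs_sigma (space M) X K)) i" for i
      by (cases i) simp_all
    show "indep_set
       (sigma_sets (space M) {Z -` A \<inter> space M |A. A \<in> sets N'})
       (sigma_sets (space M) {Y -` A \<inter> space M |A. A \<in> sets N})"
      unfolding indep_set_def
      by (rule indep_sets_mono_sets[OF indep_set_past_future[OF K, unfolded indep_set_def] sub'])
  qed
qed

text \<open>The past enters as the whole outcome: the identity, seen as a map into
  \<open>F m\<close>, has the restriction of \<open>M\<close> to \<open>F m\<close> as its law. An
  integrand may thus depend on the history in any \<open>F m\<close>-measurable way. It suffices to
  compare rectangles, where independence is the product rule.\<close>

lemma distr_past_future:
  assumes K: "K \<subseteq> {m<..}" and Y: "Y \<in> measurable (obs_sigma (space M) X K) N"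
  shows "distr M (F m) (\<lambda>\<omega>. \<omega>) \<Otimes>\<^sub>M distr M N Y = distr M (F m \<Otimes>\<^sub>M N) (\<lambda>\<omega>. (\<omega>, Y \<omega>))"
proof -
  have sub: "subalgebra M (obs_sigma (space M) X K)"
    using K by (intro subalgebra_obs_sigma) auto
  have id: "(\<lambda>\<omega>. \<omega>) \<in> measurable M (F m)"
    by (rule F_measurable[where n=m]) simp
  have YM: "Y \<in> measurable M N" by (rule measurable_from_subalg[OF sub Y])
  interpret D1: prob_space "distr M (F m) (\<lambda>\<omega>. \<omega>)" by (rule prob_space_distr[OF id])
  interpret D2: prob_space "distr M N Y" by (rule prob_space_distr[OF YM])
  show ?thesis
  proof (rule pair_measure_eqI[OF D1.sigma_finite_measure_axioms D2.sigma_finite_measure_axioms])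
    fix A B assume "A \<in> sets (distr M (F m) (\<lambda>\<omega>. \<omega>))" "B \<in> sets (distr M N Y)"
    then have A: "A \<in> sets (F m)" and B: "B \<in> sets N" by auto
    have A': "A \<subseteq> space M" using sets.sets_into_space[OF A] by simp
    have B': "Y -` B \<inter> space M \<in> sets (obs_sigma (space M) X K)"
      using measurable_sets[OF Y B] by simp
    have "emeasure (distr M (F m \<Otimes>\<^sub>M N) (\<lambda>\<omega>. (\<omega>, Y \<omega>))) (A \<times> B) =
        emeasure M (A \<inter> (Y -` B \<inter> space M))"
      by (subst emeasure_distr[OF measurable_Pair[OF id YM] pair_measureI[OF A B]])
         (rule arg_cong2[where f=emeasure], auto)
    also have "\<dots> = emeasure M A * emeasure M (Y -` B \<inter> space M)"
      using indep_set_past_future[OF K] A B' unfolding indep_sets2_eq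
      by (simp add: emeasure_eq_measure ennreal_mult)
    finally show "emeasure (distr M (F m) (\<lambda>\<omega>. \<omega>)) A * emeasure (distr M N Y) B =
        emeasure (distr M (F m \<Otimes>\<^sub>M N) (\<lambda>\<omega>. (\<omega>, Y \<omega>))) (A \<times> B)"
      using A' unfolding emeasure_distr[OF id A] emeasure_distr[OF YM B]
      by (simp add: Int_absorb2)
  next
    show "sets (distr M (F m) (\<lambda>\<omega>. \<omega>) \<Otimes>\<^sub>M distr M N Y) =
        sets (distr M (F m \<Otimes>\<^sub>M N) (\<lambda>\<omega>. (\<omega>, Y \<omega>)))"
      unfolding sets_distr by (rule sets_pair_measure_cong) simp_all
  qed
qed

text \<open>Conditioning on \<open>F (n - 1)\<close> in the form of Fubini: the past is frozen and
  only \<open>X n\<close> is integrated out. This reduces the likelihood and overshoot estimates to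
  integrals for a fixed vector \<open>v\<close>.\<close>

lemma nn_integral_fresh:
  assumes n: "n \<ge> 1"
    and f: "(\<lambda>(\<omega>, x). f \<omega> x) \<in> borel_measurable (F (n - 1) \<Otimes>\<^sub>M borel)"
  shows "(\<integral>\<^sup>+\<omega>. f \<omega> (X n \<omega>) \<partial>M) = (\<integral>\<^sup>+\<omega>. (\<integral>\<^sup>+x. f \<omega> x \<partial>mvn_measure (\<mu> n)) \<partial>M)"
proof -
  let ?D = "distr M (F (n - 1)) (\<lambda>\<omega>. \<omega>)"
  have id: "(\<lambda>\<omega>. \<omega>) \<in> measurable M (F (n - 1))"
    by (rule F_measurable[where n="n - 1"]) simp
  have X: "X n \<in> measurable M borel" using n by (rule measurable_obs)
  have eq: "?D \<Otimes>\<^sub>M mvn_measure (\<mu> n) = distr M (F (n - 1) \<Otimes>\<^sub>M borel) (\<lambda>\<omega>. (\<omega>, X n \<omega>))"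
  proof -
    have "{n} \<subseteq> {n - 1<..}" using n by auto
    from distr_past_future[OF this measurable_obs_sigma[OF singletonI]] show ?thesis
      unfolding distr_obs[OF n] .
  qed
  have "sets (?D \<Otimes>\<^sub>M mvn_measure (\<mu> n)) = sets (F (n - 1) \<Otimes>\<^sub>M borel)"
    by (rule sets_pair_measure_cong) simp_all
  then have f': "(\<lambda>(\<omega>, x). f \<omega> x) \<in> borel_measurable (?D \<Otimes>\<^sub>M mvn_measure (\<mu> n))"
    using f measurable_cong_sets by blast
  have g: "(\<lambda>\<omega>. \<integral>\<^sup>+x. f \<omega> x \<partial>mvn_measure (\<mu> n)) \<in> borel_measurable (F (n - 1))"
    using mvn.borel_measurable_nn_integral_fst[OF f'] by simp
  have "(\<integral>\<^sup>+\<omega>. f \<omega> (X n \<omega>) \<partial>M) =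
      (\<integral>\<^sup>+p. (case p of (\<omega>, x) \<Rightarrow> f \<omega> x) \<partial>distr M (F (n - 1) \<Otimes>\<^sub>M borel) (\<lambda>\<omega>. (\<omega>, X n \<omega>)))"
    using f by (subst nn_integral_distr[OF measurable_Pair[OF id X]]) simp_all
  also have "\<dots> = (\<integral>\<^sup>+\<omega>. (\<integral>\<^sup>+x. f \<omega> x \<partial>mvn_measure (\<mu> n)) \<partial>?D)"
    unfolding eq[symmetric] using mvn.nn_integral_fst[OF f'] by simp
  also have "\<dots> = (\<integral>\<^sup>+\<omega>. (\<integral>\<^sup>+x. f \<omega> x \<partial>mvn_measure (\<mu> n)) \<partial>M)"
    using g by (subst nn_integral_distr[OF id]) simp_all
  finally show ?thesis .
qed

lemma measurable_window_obs_sigma: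
  assumes "est \<in> borel_measurable (PiM {..<w} (\<lambda>_. borel))"
  shows "(\<lambda>\<omega>. window_estimate w est (\<lambda>i. X i \<omega>) (m + w + 1)) \<in>
    borel_measurable (obs_sigma (space M) X {m<..<m + w + 1})"
  unfolding window_estimate_def
  by (rule measurable_compose[OF _ assms], rule measurable_restrict, rule measurable_obs_sigma) auto

text \<open>The law of the estimate depends neither on the position of the window nor on the measure
  \<open>M\<close>, once all times in the window have mean \<open>\<theta>\<close>; so one number
  describes the error at all such times and for all change-points.\<close>

lemma nn_integral_window:
  assumes w: "w \<ge> 1" and est: "est \<in> borel_measurable (PiM {..<w} (\<lambda>_. borel))"
    and g: "g \<in> borel_measurable borel"
    and \<mu>: "\<And>i. m < i \<Longrightarrow> i \<le> m + w \<Longrightarrow> \<mu> i = \<theta>"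
  shows "(\<integral>\<^sup>+\<omega>. g (window_estimate w est (\<lambda>i. X i \<omega>) (m + w + 1)) \<partial>M) =
    (\<integral>\<^sup>+y. g (est y) \<partial>PiM {..<w} (\<lambda>_. mvn_measure \<theta>))"
proof -
  let ?Y = "\<lambda>i. X (m + 1 + i)"
  let ?P = "PiM {..<w} (\<lambda>_. borel :: (real ^ 'k) measure)"
  have Y: "indep_vars (\<lambda>_. borel) ?Y {..<w}"
  proof -
    have "indep_vars (\<lambda>_. borel) X ((\<lambda>i. m + 1 + i) ` {..<w})"
      by (rule indep_vars_subset[OF indep_obs]) auto
    then show ?thesis
      by (rule indep_vars_reindex[rotated]) (auto simp: inj_on_def)
  qed
  have rv: "?Y i \<in> borel_measurable M" for i by (rule measurable_obs) simp
  have "distr M ?P (\<lambda>\<omega>. \<lambda>i\<in>{..<w}. ?Y i \<omega>) = PiM {..<w} (\<lambda>i. distr M borel (?Y i))"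
    using Y w by (subst (asm) indep_vars_iff_distr_eq_PiM) (auto simp: rv[simplified] lessThan_empty_iff)
  also have "\<dots> = PiM {..<w} (\<lambda>_. mvn_measure \<theta>)"
    using \<mu> by (intro PiM_cong refl) (simp add: distr_obs)
  finally have eq: "distr M ?P (\<lambda>\<omega>. \<lambda>i\<in>{..<w}. ?Y i \<omega>) = PiM {..<w} (\<lambda>_. mvn_measure \<theta>)" .
  have "(\<lambda>\<omega>. \<lambda>i\<in>{..<w}. ?Y i \<omega>) \<in> measurable M ?P"
    by (intro measurable_restrict rv)
  then have "(\<integral>\<^sup>+y. g (est y) \<partial>PiM {..<w} (\<lambda>_. mvn_measure \<theta>)) =
      (\<integral>\<^sup>+\<omega>. g (est (\<lambda>i\<in>{..<w}. ?Y i \<omega>)) \<partial>M)"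
    unfolding eq[symmetric] using est g by (subst nn_integral_distr) auto
  then show ?thesis by (simp add: window_estimate_def)
qed

end

section \<open>False alarms\<close>

locale wl_cusum_test = gaussian_obs M X \<mu> for M :: "'a measure"
    and X :: "nat \<Rightarrow> 'a \<Rightarrow> real ^ 'k" and \<mu> :: "nat \<Rightarrow> real ^ 'k" +
  fixes w :: nat and est :: "(nat \<Rightarrow> real ^ 'k) \<Rightarrow> real ^ 'k" and b :: real
  assumes w: "w \<ge> 1"
    and est: "est \<in> borel_measurable (PiM {..<w} (\<lambda>_. borel))"
    and b: "b \<ge> 0"
begin

definition S :: "nat \<Rightarrow> 'a \<Rightarrow> real" where
  "S n \<omega> = wl_cusum w est (\<lambda>i. X i \<omega>) n"

definition theta_hat :: "nat \<Rightarrow> 'a \<Rightarrow> real ^ 'k" where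
  "theta_hat n \<omega> = window_estimate w est (\<lambda>i. X i \<omega>) n"

definition incr :: "nat \<Rightarrow> 'a \<Rightarrow> real" where
  "incr n \<omega> = theta_hat n \<omega> \<bullet> X n \<omega> - (norm (theta_hat n \<omega>))\<^sup>2 / 2"

abbreviation T :: "'a \<Rightarrow> enat" where
  "T \<equiv> wl_cusum_time w est X b"

text \<open>\<open>n \<le> T\<close> rather than \<open>n < T\<close>: this is decided by the
  observations up to \<open>n - 1\<close>, so its indicator counts as past when \<open>X n\<close>
  is integrated out.\<close>

definition alive :: "nat \<Rightarrow> 'a set" where
  "alive n = {\<omega> \<in> space M. enat n \<le> T \<omega>}"

lemma S_Suc: "w \<le> n \<Longrightarrow> S (Suc n) \<omega> = max 0 (S n \<omega>) + incr (Suc n) \<omega>"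
  by (simp add: S_def theta_hat_def incr_def)

lemma S_eq_0: "n \<le> w \<Longrightarrow> S n \<omega> = 0"
  by (cases n) (simp_all add: S_def)

lemma measurable_S: "S n \<in> borel_measurable (F n)"
  unfolding S_def[abs_def]
  by (rule measurable_wl_cusum[OF est]) (auto intro: measurable_obs_filtration)

lemma measurable_theta_hat: "w < n \<Longrightarrow> theta_hat n \<in> borel_measurable (F (n - 1))"
  unfolding theta_hat_def[abs_def]
  by (rule measurable_window_estimate[OF est]) (auto intro: measurable_obs_filtration)

lemma measurable_incr: "w < n \<Longrightarrow> incr n \<in> borel_measurable M"
proof -
  assume n: "w < n"
  have [measurable]: "theta_hat n \<in> borel_measurable M" "X n \<in> borel_measurable M"
    using F_measurable[OF measurable_theta_hat[OF n]] measurable_obs[of n] n by auto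
  show ?thesis unfolding incr_def[abs_def] by measurable
qed

lemma measurable_T: "T \<in> measurable M (count_space UNIV)"
  by (rule measurable_wl_cusum_time[OF est measurable_obs])

lemma mem_alive_iff: "\<omega> \<in> alive n \<longleftrightarrow> \<omega> \<in> space M \<and> (\<forall>m<n. w < m \<longrightarrow> S m \<omega> \<le> b)"
proof (cases n)
  case 0
  then show ?thesis by (simp add: alive_def zero_enat_def[symmetric])
next
  case (Suc k)
  have "enat (Suc k) \<le> t \<longleftrightarrow> \<not> t \<le> enat k" for t
    by (cases t) auto
  then show ?thesis
    unfolding Suc alive_def by (auto simp: wl_cusum_time_le_iff S_def less_Suc_eq_le not_less)
qed

lemma alive_eq_space: "n \<le> Suc w \<Longrightarrow> alive n = space M"
  by (auto simp: mem_alive_iff)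

lemma alive_Suc: "w < n \<Longrightarrow> alive (Suc n) = {\<omega> \<in> alive n. S n \<omega> \<le> b}"
  by (auto simp: mem_alive_iff less_Suc_eq)

lemma alive_antimono: "m \<le> n \<Longrightarrow> alive n \<subseteq> alive m"
  by (auto simp: mem_alive_iff)

lemma alive_F: "alive n \<in> sets (F (n - 1))"
proof (cases n)
  case 0
  then show ?thesis using alive_eq_space[of n] sets.top[of "F (n - 1)"] by simp
next
  case (Suc k)
  have "enat (Suc k) \<le> t \<longleftrightarrow> \<not> t \<le> enat k" for t
    by (cases t) auto
  then have "alive n = space (F k) - {\<omega> \<in> space M. T \<omega> \<le> enat k}"
    by (auto simp: alive_def Suc)
  also have "\<dots> \<in> sets (F k)"
    by (intro sets.compl_sets stopping_time_wl_cusum_time[OF est])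
  finally show ?thesis using Suc by simp
qed

lemma alive_sets: "alive n \<in> sets M"
  by (rule F_sets[OF alive_F])

text \<open>Given the past, \<open>exp (incr n \<omega>)\<close> is the likelihood ratio of mean
  \<open>theta_hat n \<omega>\<close> against mean 0 and integrates to 1.\<close>

lemma nn_integral_alive_likelihood:
  assumes \<mu>0: "\<mu> n = 0" and n: "w < n"
  shows "(\<integral>\<^sup>+\<omega>. indicator (alive n) \<omega> * ennreal (exp (S n \<omega>)) \<partial>M) =
    (\<integral>\<^sup>+\<omega>. indicator (alive n) \<omega> * ennreal (exp (max 0 (S (n - 1) \<omega>))) \<partial>M)"
proof -
  have n1: "n \<ge> 1" using n by simp
  have [measurable]: "theta_hat n \<in> borel_measurable (F (n - 1))" by (rule measurable_theta_hat[OF n])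
  have [measurable]: "S (n - 1) \<in> borel_measurable (F (n - 1))" by (rule measurable_S)
  have [measurable]: "alive n \<in> sets (F (n - 1))" by (rule alive_F)
  let ?g = "\<lambda>\<omega>. indicator (alive n) \<omega> * ennreal (exp (max 0 (S (n - 1) \<omega>)))"
  have "(\<integral>\<^sup>+\<omega>. indicator (alive n) \<omega> * ennreal (exp (S n \<omega>)) \<partial>M) =
      (\<integral>\<^sup>+\<omega>. ?g \<omega> * ennreal (exp (theta_hat n \<omega> \<bullet> X n \<omega> - (norm (theta_hat n \<omega>))\<^sup>2 / 2)) \<partial>M)"
    using S_Suc[of "n - 1"] n
    by (intro nn_integral_cong) (simp add: incr_def exp_add ennreal_mult mult.assoc)
  also have "\<dots> = (\<integral>\<^sup>+\<omega>. (\<integral>\<^sup>+x. ?g \<omega> * ennreal (exp (theta_hat n \<omega> \<bullet> x - (norm (theta_hat n \<omega>))\<^sup>2 / 2))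
      \<partial>mvn_measure (\<mu> n)) \<partial>M)"
    by (rule nn_integral_fresh[OF n1]) measurable
  also have "\<dots> = (\<integral>\<^sup>+\<omega>. ?g \<omega> \<partial>M)"
    unfolding \<mu>0 by (intro nn_integral_cong)
      (subst nn_integral_cmult, auto simp: nn_integral_mvn_likelihood_ratio)
  finally show ?thesis .
qed

text \<open>The integral over \<open>alive n\<close> is carried through the induction as a reserve.
  The alarms at time \<open>n\<close>, where \<open>S n\<close> exceeds \<open>b\<close>, are paid
  out of it, and reflection at 0 refills it by at most \<open>emeasure M (alive (Suc n))\<close>. At
  time \<open>Suc w\<close> the reserve is 1, because \<open>S w\<close> is 0.\<close>

lemma alive_sum_ge:
  assumes \<mu>0: "\<And>n. n \<ge> 1 \<Longrightarrow> \<mu> n = 0" and n: "w < n"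
  shows "(\<integral>\<^sup>+\<omega>. indicator (alive n) \<omega> * ennreal (exp (S n \<omega>)) \<partial>M) +
      ennreal (exp b) * emeasure M (space M - alive n) \<le> (\<Sum>k\<in>{w<..n}. emeasure M (alive k))"
proof -
  have n': "Suc w \<le> n" using n by simp
  then show ?thesis
  proof (induction n rule: dec_induct)
    case base
    have "{w<..Suc w} = {Suc w}" by auto
    then show ?case
      using nn_integral_alive_likelihood[OF \<mu>0, of "Suc w"]
      by (simp add: alive_eq_space S_eq_0)
  next
    case (step n)
    have [measurable]: "S n \<in> borel_measurable M" by (rule F_measurable[OF measurable_S])
    have [measurable]: "alive n \<in> sets M" for n by (rule alive_sets)
    let ?f = "\<lambda>\<omega>. indicator (alive (Suc n)) \<omega> * ennreal (exp (S n \<omega>))"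
    have sub: "alive (Suc n) \<subseteq> alive n" by (rule alive_antimono) simp
    have "(\<integral>\<^sup>+\<omega>. indicator (alive (Suc n)) \<omega> * ennreal (exp (S (Suc n) \<omega>)) \<partial>M) =
        (\<integral>\<^sup>+\<omega>. indicator (alive (Suc n)) \<omega> * ennreal (exp (max 0 (S n \<omega>))) \<partial>M)"
      using nn_integral_alive_likelihood[OF \<mu>0, of "Suc n"] step by simp
    also have "\<dots> \<le> (\<integral>\<^sup>+\<omega>. indicator (alive (Suc n)) \<omega> + ?f \<omega> \<partial>M)"
    proof (intro nn_integral_mono)
      fix \<omega>
      have "ennreal (exp (max 0 (S n \<omega>))) \<le> ennreal (1 + exp (S n \<omega>))"
        by (intro ennreal_leI) (auto simp: max_def)
      then show "indicator (alive (Suc n)) \<omega> * ennreal (exp (max 0 (S n \<omega>))) \<le>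
          indicator (alive (Suc n)) \<omega> + ?f \<omega>"
        by (cases "\<omega> \<in> alive (Suc n)") auto
    qed
    also have "\<dots> = emeasure M (alive (Suc n)) + (\<integral>\<^sup>+\<omega>. ?f \<omega> \<partial>M)"
      by (subst nn_integral_add) auto
    finally have 1: "(\<integral>\<^sup>+\<omega>. indicator (alive (Suc n)) \<omega> * ennreal (exp (S (Suc n) \<omega>)) \<partial>M) \<le>
        emeasure M (alive (Suc n)) + (\<integral>\<^sup>+\<omega>. ?f \<omega> \<partial>M)" .
    have "(\<integral>\<^sup>+\<omega>. ?f \<omega> \<partial>M) + ennreal (exp b) * emeasure M (alive n - alive (Suc n)) =
        (\<integral>\<^sup>+\<omega>. ?f \<omega> + ennreal (exp b) * indicator (alive n - alive (Suc n)) \<omega> \<partial>M)"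
      by (subst nn_integral_add) (auto simp: nn_integral_cmult_indicator)
    also have "\<dots> \<le> (\<integral>\<^sup>+\<omega>. indicator (alive n) \<omega> * ennreal (exp (S n \<omega>)) \<partial>M)"
    proof (intro nn_integral_mono)
      fix \<omega>
      show "?f \<omega> + ennreal (exp b) * indicator (alive n - alive (Suc n)) \<omega> \<le>
          indicator (alive n) \<omega> * ennreal (exp (S n \<omega>))"
        using sub alive_Suc[of n] step
        by (cases "\<omega> \<in> alive n"; cases "\<omega> \<in> alive (Suc n)") (auto intro!: ennreal_leI)
    qed
    finally have 2: "(\<integral>\<^sup>+\<omega>. ?f \<omega> \<partial>M) + ennreal (exp b) * emeasure M (alive n - alive (Suc n)) \<le>
        (\<integral>\<^sup>+\<omega>. indicator (alive n) \<omega> * ennreal (exp (S n \<omega>)) \<partial>M)" .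
    have "space M - alive (Suc n) = (space M - alive n) \<union> (alive n - alive (Suc n))"
      using sub sets.sets_into_space[OF alive_sets] by blast
    moreover have "emeasure M (space M - alive n) + emeasure M (alive n - alive (Suc n)) =
        emeasure M ((space M - alive n) \<union> (alive n - alive (Suc n)))"
      by (rule plus_emeasure) auto
    ultimately have 3: "emeasure M (space M - alive (Suc n)) =
        emeasure M (space M - alive n) + emeasure M (alive n - alive (Suc n))"
      by simp
    have "{w<..Suc n} = insert (Suc n) {w<..n}" using step by auto
    then have 4: "(\<Sum>k\<in>{w<..Suc n}. emeasure M (alive k)) =
        emeasure M (alive (Suc n)) + (\<Sum>k\<in>{w<..n}. emeasure M (alive k))" by simp
    have "(\<integral>\<^sup>+\<omega>. indicator (alive (Suc n)) \<omega> * ennreal (exp (S (Suc n) \<omega>)) \<partial>M) +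
        ennreal (exp b) * emeasure M (space M - alive (Suc n)) \<le>
        emeasure M (alive (Suc n)) + ((\<integral>\<^sup>+\<omega>. ?f \<omega> \<partial>M) +
          ennreal (exp b) * emeasure M (alive n - alive (Suc n)) +
          ennreal (exp b) * emeasure M (space M - alive n))"
      using add_right_mono[OF 1] unfolding 3 by (simp add: distrib_left add_ac)
    also have "\<dots> \<le> emeasure M (alive (Suc n)) +
        ((\<integral>\<^sup>+\<omega>. indicator (alive n) \<omega> * ennreal (exp (S n \<omega>)) \<partial>M) +
          ennreal (exp b) * emeasure M (space M - alive n))"
      by (intro add_left_mono add_right_mono 2)
    also have "\<dots> \<le> emeasure M (alive (Suc n)) + (\<Sum>k\<in>{w<..n}. emeasure M (alive k))"
      by (intro add_left_mono step.IH)
    finally show ?case unfolding 4 .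
  qed
qed

lemma nn_integral_T_eq_suminf:
  "(\<integral>\<^sup>+\<omega>. ennreal_of_enat (T \<omega>) \<partial>M) = (\<Sum>t. emeasure M (alive (Suc t)))"
proof -
  have "enat t < u \<longleftrightarrow> enat (Suc t) \<le> u" for t u
    by (cases u) auto
  then show ?thesis
    by (simp add: nn_integral_enat_function[OF measurable_T] alive_def)
qed

lemma average_run_length:
  assumes \<mu>0: "\<And>n. n \<ge> 1 \<Longrightarrow> \<mu> n = 0"
  shows "ennreal (exp b) \<le> (\<integral>\<^sup>+\<omega>. ennreal_of_enat (T \<omega>) \<partial>M)"
proof (cases "(\<integral>\<^sup>+\<omega>. ennreal_of_enat (T \<omega>) \<partial>M) = \<top>")
  case False
  \<comment> \<open>A finite mean makes the survival probabilities tend to 0, so the bound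
    approaches its full value \<open>exp b\<close>.\<close>
  then have fin: "(\<Sum>t. ennreal (prob (alive (Suc t)))) \<noteq> \<top>"
    by (simp add: nn_integral_T_eq_suminf emeasure_eq_measure)
  then have "summable (\<lambda>t. prob (alive (Suc t)))"
    by (intro summable_suminf_not_top) auto
  then have "(\<lambda>t. prob (alive (Suc t))) \<longlonglongrightarrow> 0" by (rule summable_LIMSEQ_zero)
  then have "(\<lambda>t. exp b * (1 - prob (alive (Suc t)))) \<longlonglongrightarrow> exp b * (1 - 0)"
    by (intro tendsto_intros)
  then have lim: "(\<lambda>t. ennreal (exp b * (1 - prob (alive (Suc t))))) \<longlonglongrightarrow> ennreal (exp b)"
    by (intro tendsto_ennrealI) simp
  have "ennreal (exp b * (1 - prob (alive (Suc t)))) \<le> (\<integral>\<^sup>+\<omega>. ennreal_of_enat (T \<omega>) \<partial>M)"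
    if t: "w \<le> t" for t
  proof -
    have "ennreal (exp b * (1 - prob (alive (Suc t)))) =
        ennreal (exp b) * emeasure M (space M - alive (Suc t))"
      by (simp add: emeasure_eq_measure prob_compl[OF alive_sets] ennreal_mult)
    also have "\<dots> \<le> (\<Sum>k\<in>{w<..Suc t}. emeasure M (alive k))"
      using t by (intro order_trans[OF _ alive_sum_ge[OF \<mu>0, of "Suc t"]]) (simp_all add: add_increasing)
    also have "\<dots> = (\<Sum>k\<in>{w..<Suc t}. emeasure M (alive (Suc k)))"
      by (rule sum.reindex_bij_witness[of _ Suc "\<lambda>k. k - 1"]) auto
    \<comment> \<open>Only times after \<open>w\<close> were counted; the first \<open>w\<close>
      terms of the tail sum for the mean are given away here.\<close>
    also have "\<dots> \<le> (\<Sum>t. emeasure M (alive (Suc t)))"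
      by (rule sum_le_suminf) auto
    finally show ?thesis by (simp add: nn_integral_T_eq_suminf)
  qed
  then show ?thesis
    by (intro LIMSEQ_le_const2[OF lim] exI[of _ w]) blast
qed simp

end

section \<open>Increments after the change\<close>

text \<open>The error is fixed through the product law of a window and not through \<open>M\<close>,
  because the laws for different \<open>\<nu>\<close> are different measures, while the mean square
  error refers to \<open>\<nu> = 1\<close>.\<close>

locale wl_cusum_change = wl_cusum_test M X \<mu> w est b for M :: "'a measure"
    and X :: "nat \<Rightarrow> 'a \<Rightarrow> real ^ 'k" and \<mu> w est b +
  fixes \<nu> :: nat and \<theta> :: "real ^ 'k" and mse :: real
  assumes \<nu>: "\<nu> \<ge> 1" and \<mu>_change: "\<And>n. n \<ge> \<nu> \<Longrightarrow> \<mu> n = \<theta>"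
    and mse_nonneg: "mse \<ge> 0"
    and mse: "(\<integral>\<^sup>+y. ennreal ((norm (\<theta> - est y))\<^sup>2) \<partial>PiM {..<w} (\<lambda>_. mvn_measure \<theta>)) = ennreal mse"
begin

abbreviation sq_err :: "nat \<Rightarrow> 'a \<Rightarrow> real" where
  "sq_err n \<omega> \<equiv> (norm (\<theta> - theta_hat n \<omega>))\<^sup>2"

lemma measurable_sq_err: "w < n \<Longrightarrow> sq_err n \<in> borel_measurable (F (n - 1))"
  using measurable_theta_hat[of n] by measurable

lemma sq_err_has_integral:
  assumes n: "\<nu> + w \<le> n"
  shows "has_bochner_integral M (sq_err n) mse"
proof -
  have n': "n - w - 1 + w + 1 = n" using n \<nu> by simp
  have [measurable]: "sq_err n \<in> borel_measurable M"
    using n \<nu> by (intro F_measurable[OF measurable_sq_err]) auto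
  have "(\<integral>\<^sup>+\<omega>. ennreal (sq_err n \<omega>) \<partial>M) =
      (\<integral>\<^sup>+y. ennreal ((norm (\<theta> - est y))\<^sup>2) \<partial>PiM {..<w} (\<lambda>_. mvn_measure \<theta>))"
    using nn_integral_window[OF w est, of "\<lambda>x. ennreal ((norm (\<theta> - x))\<^sup>2)" "n - w - 1" \<theta>] n \<nu>
    unfolding n' theta_hat_def by (simp add: \<mu>_change)
  then show ?thesis
    unfolding mse by (intro has_bochner_integral_nn_integral) (auto simp: mse_nonneg)
qed

lemmas integrable_sq_err = integrable.intros[OF sq_err_has_integral]
  and integral_sq_err = has_bochner_integral_integral_eq[OF sq_err_has_integral]

text \<open>The window covers the times from \<open>n - w\<close> to \<open>n - 1\<close>, after
  everything on which \<open>C\<close> depends, so the expectation factorises. An event such as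
  \<open>alive n\<close> can involve the same observations as the estimate, which is why a gap of
  \<open>w\<close> is kept.\<close>

lemma integral_past_sq_err:
  assumes n: "\<nu> + w \<le> n" and C: "C \<in> sets (F (n - w - 1))"
  shows "(\<integral>\<omega>. indicator C \<omega> * sq_err n \<omega> \<partial>M) = prob C * mse"
proof -
  let ?m = "n - w - 1"
  have n': "?m + w + 1 = n" using n \<nu> by simp
  have "theta_hat n \<in> borel_measurable (obs_sigma (space M) X {?m<..<?m + w + 1})"
    using measurable_window_obs_sigma[OF est, of ?m] unfolding n' theta_hat_def[abs_def] .
  then have Y: "sq_err n \<in> borel_measurable (obs_sigma (space M) X {?m<..<?m + w + 1})"
    by measurable
  have "indep_var borel (indicator C :: _ \<Rightarrow> real) borel (sq_err n)"
    using C by (intro indep_var_past_future[OF _ Y]) auto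
  then have "(\<integral>\<omega>. indicator C \<omega> * sq_err n \<omega> \<partial>M) = (\<integral>\<omega>. indicator C \<omega> \<partial>M) * (\<integral>\<omega>. sq_err n \<omega> \<partial>M)"
    using F_sets[OF C]
    by (intro indep_var_lebesgue_integral integrable_sq_err n integrable_real_indicator)
       (auto simp: emeasure_eq_measure)
  then show ?thesis
    using F_sets[OF C] sets.sets_into_space[OF F_sets[OF C]] n by (simp add: integral_sq_err Int_absorb2)
qed

text \<open>The finite mean square error controls the size of the estimate: t \<le> 1 + t^2 turns it
  into a first moment.\<close>

lemma integrable_theta_hat_inner:
  assumes n: "\<nu> + w \<le> n"
  shows "integrable M (\<lambda>\<omega>. theta_hat n \<omega> \<bullet> u)"
proof (rule Bochner_Integration.integrable_bound)
  show "integrable M (\<lambda>\<omega>. (norm \<theta> + 1 + sq_err n \<omega>) * norm u)"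
    using integrable_sq_err[OF n] by auto
  have [measurable]: "theta_hat n \<in> borel_measurable M"
    using n \<nu> by (intro F_measurable[OF measurable_theta_hat]) auto
  show "(\<lambda>\<omega>. theta_hat n \<omega> \<bullet> u) \<in> borel_measurable M" by measurable
  show "AE \<omega> in M. norm (theta_hat n \<omega> \<bullet> u) \<le> norm ((norm \<theta> + 1 + sq_err n \<omega>) * norm u)"
  proof (rule AE_I2)
    fix \<omega>
    have "norm (theta_hat n \<omega>) \<le> norm \<theta> + norm (\<theta> - theta_hat n \<omega>)"
      using norm_triangle_ineq4[of \<theta> "\<theta> - theta_hat n \<omega>"] by simp
    also have "norm (\<theta> - theta_hat n \<omega>) \<le> 1 + sq_err n \<omega>"
      using self_le_power[of "norm (\<theta> - theta_hat n \<omega>)" 2] by (cases "norm (\<theta> - theta_hat n \<omega>) \<le> 1") (auto intro: add_increasing2)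
    finally have "norm (theta_hat n \<omega>) * norm u \<le> (norm \<theta> + 1 + sq_err n \<omega>) * norm u"
      by (intro mult_right_mono) auto
    then show "norm (theta_hat n \<omega> \<bullet> u) \<le> norm ((norm \<theta> + 1 + sq_err n \<omega>) * norm u)"
      using Cauchy_Schwarz_ineq2[of "theta_hat n \<omega>" u] by (simp add: abs_mult)
  qed
qed

lemma obs_inner_has_integral:
  assumes n: "\<nu> \<le> n"
  shows "has_bochner_integral M (\<lambda>\<omega>. X n \<omega> \<bullet> u) (\<theta> \<bullet> u)"
proof -
  have n1: "n \<ge> 1" using n \<nu> by simp
  have "has_bochner_integral (distr M borel (X n)) (\<lambda>x. x \<bullet> u) (\<theta> \<bullet> u)"
    unfolding distr_obs[OF n1] \<mu>_change[OF n]
    using integrable_mvn_measure_inner[of \<theta> u] integral_mvn_measure_inner[of \<theta> u]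
    by (simp add: has_bochner_integral_iff inner_commute)
  then show ?thesis
    using measurable_obs[OF n1]
    by (auto simp: has_bochner_integral_iff integrable_distr_eq integral_distr)
qed

text \<open>Splitting the inner product along the basis leaves products of a past real variable and
  a centred one independent of it; independence gives both integrability and mean 0 from first
  moments.\<close>

lemma innovation_has_integral:
  assumes n: "\<nu> + w \<le> n" and C: "C \<in> sets (F (n - 1))"
  shows "has_bochner_integral M (\<lambda>\<omega>. indicator C \<omega> * (theta_hat n \<omega> \<bullet> (X n \<omega> - \<theta>))) 0"
proof -
  have wn: "w < n" using n \<nu> by simp
  have "has_bochner_integral M (\<lambda>\<omega>. (indicator C \<omega> * (theta_hat n \<omega> \<bullet> u)) * (X n \<omega> \<bullet> u - \<theta> \<bullet> u)) 0" for u
  proof -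
    let ?Z = "\<lambda>\<omega>. indicator C \<omega> * (theta_hat n \<omega> \<bullet> u)" and ?Y = "\<lambda>\<omega>. X n \<omega> \<bullet> u - \<theta> \<bullet> u"
    have [measurable]: "theta_hat n \<in> borel_measurable (F (n - 1))" by (rule measurable_theta_hat[OF wn])
    have [measurable]: "X n \<in> borel_measurable (obs_sigma (space M) X {n})"
      by (rule measurable_obs_sigma) simp
    have [measurable]: "C \<in> sets (F (n - 1))" by (rule C)
    have mZ: "?Z \<in> borel_measurable (F (n - 1))" by measurable
    have mY: "?Y \<in> borel_measurable (obs_sigma (space M) X {n})" by measurable
    have "{n} \<subseteq> {n - 1<..}" using wn by auto
    then have ind: "indep_var borel ?Z borel ?Y" by (rule indep_var_past_future[OF _ mY mZ])
    have Z: "integrable M ?Z"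
      using integrable_mult_indicator[OF F_sets[OF C] integrable_theta_hat_inner[OF n]] by simp
    have Y: "has_bochner_integral M ?Y 0"
      using obs_inner_has_integral[of n u] n by (simp add: has_bochner_integral_iff prob_space)
    show ?thesis
      using indep_var_integrable[OF ind Z] indep_var_lebesgue_integral[OF ind Z] Y
      by (simp add: has_bochner_integral_iff)
  qed
  then have "has_bochner_integral M (\<lambda>\<omega>. \<Sum>u\<in>Basis. (indicator C \<omega> * (theta_hat n \<omega> \<bullet> u)) * (X n \<omega> \<bullet> u - \<theta> \<bullet> u))
      (\<Sum>u\<in>(Basis :: (real ^ 'k) set). 0)"
    by (intro has_bochner_integral_sum) auto
  also have "(\<lambda>\<omega>. \<Sum>u\<in>Basis. (indicator C \<omega> * (theta_hat n \<omega> \<bullet> u)) * (X n \<omega> \<bullet> u - \<theta> \<bullet> u)) =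
      (\<lambda>\<omega>. indicator C \<omega> * (theta_hat n \<omega> \<bullet> (X n \<omega> - \<theta>)))"
    by (simp add: euclidean_inner[of "theta_hat n _" "X n _ - \<theta>"] inner_diff_left sum_distrib_left mult.assoc)
  finally show ?thesis by simp
qed

text \<open>Completing the square around \<open>\<theta>\<close> separates a centred innovation from
  the drift; the estimation error appears as a loss of drift.\<close>

lemma incr_eq: "incr n \<omega> = theta_hat n \<omega> \<bullet> (X n \<omega> - \<theta>) + ((norm \<theta>)\<^sup>2 / 2 - sq_err n \<omega> / 2)"
  by (simp add: incr_def power2_norm_eq_inner inner_diff_left inner_diff_right inner_commute field_simps)

lemma incr_has_integral:
  assumes n: "\<nu> + w \<le> n" and C: "C \<in> sets (F (n - 1))"
  shows "has_bochner_integral M (\<lambda>\<omega>. indicator C \<omega> * incr n \<omega>)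
    (prob C * ((norm \<theta>)\<^sup>2 / 2) - (\<integral>\<omega>. indicator C \<omega> * sq_err n \<omega> \<partial>M) / 2)"
proof -
  have C': "C \<in> sets M" by (rule F_sets[OF C])
  have CS: "C \<subseteq> space M" by (rule sets.sets_into_space[OF C'])
  have 1: "has_bochner_integral M (\<lambda>\<omega>. indicator C \<omega> * sq_err n \<omega>) (\<integral>\<omega>. indicator C \<omega> * sq_err n \<omega> \<partial>M)"
    using integrable_mult_indicator[OF C' integrable_sq_err[OF n]] by (simp add: has_bochner_integral_iff)
  have 2: "has_bochner_integral M (\<lambda>\<omega>. indicator C \<omega> * ((norm \<theta>)\<^sup>2 / 2)) (prob C * ((norm \<theta>)\<^sup>2 / 2))"
    using C' CS integrable_real_indicator[OF C']
    by (intro has_bochner_integral_mult_left)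
       (simp add: has_bochner_integral_iff Int_absorb2 emeasure_eq_measure)
  have "has_bochner_integral M (\<lambda>\<omega>. indicator C \<omega> * (theta_hat n \<omega> \<bullet> (X n \<omega> - \<theta>)) +
      (indicator C \<omega> * ((norm \<theta>)\<^sup>2 / 2) - indicator C \<omega> * sq_err n \<omega> / 2))
      (0 + (prob C * ((norm \<theta>)\<^sup>2 / 2) - (\<integral>\<omega>. indicator C \<omega> * sq_err n \<omega> \<partial>M) / 2))"
    by (intro has_bochner_integral_add has_bochner_integral_diff innovation_has_integral[OF n C] 2
        has_bochner_integral_divide_zero 1)
  then show ?thesis
    by (simp add: incr_eq algebra_simps)
qed

text \<open>Estimation errors can only lower the drift. This crude bound serves on events that
  overlap the window, where the error cannot be averaged independently.\<close>

lemma integral_incr_le: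
  assumes n: "\<nu> + w \<le> n" and C: "C \<in> sets (F (n - 1))"
  shows "(\<integral>\<omega>. indicator C \<omega> * incr n \<omega> \<partial>M) \<le> prob C * ((norm \<theta>)\<^sup>2 / 2)"
proof -
  have "0 \<le> (\<integral>\<omega>. indicator C \<omega> * sq_err n \<omega> \<partial>M)" by (rule Bochner_Integration.integral_nonneg) simp
  then show ?thesis
    using has_bochner_integral_integral_eq[OF incr_has_integral[OF n C]] by simp
qed

lemma integral_past_incr:
  assumes n: "\<nu> + w \<le> n" and C: "C \<in> sets (F (n - w - 1))"
  shows "(\<integral>\<omega>. indicator C \<omega> * incr n \<omega> \<partial>M) = prob C * ((norm \<theta>)\<^sup>2 / 2 - mse / 2)"
proof -
  have "C \<in> sets (F (n - 1))" by (rule F_mono[OF C]) simp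
  from has_bochner_integral_integral_eq[OF incr_has_integral[OF n this]] show ?thesis
    by (simp add: integral_past_sq_err[OF n C] algebra_simps)
qed

text \<open>Barrier and estimate both belong to the past, so \<open>nn_integral_fresh\<close>
  freezes them and the bound for a fixed vector applies; its second use turns the inner crossing
  probability back into an event of \<open>M\<close>.\<close>

lemma integral_overshoot_le:
  assumes n: "\<nu> + w \<le> n" and C: "C \<in> sets (F (n - 1))"
    and c: "c \<in> borel_measurable (F (n - 1))" and c0: "\<And>\<omega>. \<omega> \<in> C \<Longrightarrow> 0 \<le> c \<omega>"
  shows "(\<integral>\<omega>. indicator C \<omega> * max 0 (incr n \<omega> - c \<omega>) \<partial>M) \<le>
    ((norm \<theta>)\<^sup>2 / 2 + 2) * prob {\<omega> \<in> C. c \<omega> < incr n \<omega>}"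
proof -
  have wn: "w < n" "n \<ge> 1" "n \<ge> \<nu>" using n \<nu> by auto
  have C': "C \<in> sets M" by (rule F_sets[OF C])
  have CS: "C \<subseteq> space M" by (rule sets.sets_into_space[OF C'])
  have [measurable]: "C \<in> sets M" by (rule C')
  have [measurable]: "C \<in> sets (F (n - 1))" by (rule C)
  have [measurable]: "c \<in> borel_measurable (F (n - 1))" by (rule c)
  have [measurable]: "c \<in> borel_measurable M" by (rule F_measurable[OF c])
  have [measurable]: "incr n \<in> borel_measurable M" by (rule measurable_incr[OF wn(1)])
  have [measurable]: "theta_hat n \<in> borel_measurable (F (n - 1))" by (rule measurable_theta_hat[OF wn(1)])
  let ?L = "(norm \<theta>)\<^sup>2 / 2 + 2"
  have [simp]: "?L \<ge> 0" by simp
  have set: "{\<omega> \<in> C. c \<omega> < incr n \<omega>} \<in> sets M"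
  proof -
    have "{\<omega> \<in> C. c \<omega> < incr n \<omega>} = C \<inter> {\<omega> \<in> space M. c \<omega> < incr n \<omega>}" using CS by auto
    then show ?thesis by simp
  qed
  have "(\<integral>\<^sup>+\<omega>. ennreal (indicator C \<omega> * max 0 (incr n \<omega> - c \<omega>)) \<partial>M) =
      (\<integral>\<^sup>+\<omega>. indicator C \<omega> * ennreal (theta_hat n \<omega> \<bullet> X n \<omega> - (norm (theta_hat n \<omega>))\<^sup>2 / 2 - c \<omega>) \<partial>M)"
    by (intro nn_integral_cong) (auto simp: indicator_def incr_def max_def ennreal_neg)
  also have "\<dots> = (\<integral>\<^sup>+\<omega>. (\<integral>\<^sup>+x. indicator C \<omega> * ennreal (theta_hat n \<omega> \<bullet> x - (norm (theta_hat n \<omega>))\<^sup>2 / 2 - c \<omega>)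
      \<partial>mvn_measure (\<mu> n)) \<partial>M)"
    by (rule nn_integral_fresh[OF wn(2)]) measurable
  also have "\<dots> \<le> (\<integral>\<^sup>+\<omega>. (\<integral>\<^sup>+x. indicator C \<omega> * (ennreal ?L *
      indicator {x. c \<omega> < theta_hat n \<omega> \<bullet> x - (norm (theta_hat n \<omega>))\<^sup>2 / 2} x) \<partial>mvn_measure (\<mu> n)) \<partial>M)"
  proof (rule nn_integral_mono)
    fix \<omega>
    show "(\<integral>\<^sup>+x. indicator C \<omega> * ennreal (theta_hat n \<omega> \<bullet> x - (norm (theta_hat n \<omega>))\<^sup>2 / 2 - c \<omega>) \<partial>mvn_measure (\<mu> n)) \<le>
        (\<integral>\<^sup>+x. indicator C \<omega> * (ennreal ?L *
          indicator {x. c \<omega> < theta_hat n \<omega> \<bullet> x - (norm (theta_hat n \<omega>))\<^sup>2 / 2} x) \<partial>mvn_measure (\<mu> n))"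
      using mvn_measure_overshoot[OF c0, of \<omega> \<theta> "theta_hat n \<omega>"] \<mu>_change[OF wn(3)]
      by (cases "\<omega> \<in> C") simp_all
  qed
  also have "\<dots> = (\<integral>\<^sup>+\<omega>. indicator C \<omega> * (ennreal ?L *
      indicator {x. c \<omega> < theta_hat n \<omega> \<bullet> x - (norm (theta_hat n \<omega>))\<^sup>2 / 2} (X n \<omega>)) \<partial>M)"
    by (rule nn_integral_fresh[OF wn(2), symmetric]) measurable
  also have "\<dots> = (\<integral>\<^sup>+\<omega>. ennreal ?L * indicator {\<omega> \<in> C. c \<omega> < incr n \<omega>} \<omega> \<partial>M)"
    by (intro nn_integral_cong) (auto simp: indicator_def incr_def)
  also have "\<dots> = ennreal (?L * prob {\<omega> \<in> C. c \<omega> < incr n \<omega>})"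
    using set by (simp add: nn_integral_cmult_indicator emeasure_eq_measure ennreal_mult)
  finally have le: "(\<integral>\<^sup>+\<omega>. ennreal (indicator C \<omega> * max 0 (incr n \<omega> - c \<omega>)) \<partial>M) \<le>
      ennreal (?L * prob {\<omega> \<in> C. c \<omega> < incr n \<omega>})" .
  have "(\<integral>\<omega>. indicator C \<omega> * max 0 (incr n \<omega> - c \<omega>) \<partial>M) =
      enn2real (\<integral>\<^sup>+\<omega>. ennreal (indicator C \<omega> * max 0 (incr n \<omega> - c \<omega>)) \<partial>M)"
    by (rule integral_eq_nn_integral) auto
  also have "\<dots> \<le> enn2real (ennreal (?L * prob {\<omega> \<in> C. c \<omega> < incr n \<omega>}))"
    by (rule enn2real_mono[OF le]) simp
  finally show ?thesis by simp
qed

end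

section \<open>Detection delay\<close>

context wl_cusum_change
begin

text \<open>Up to the alarm an increment is at most the change of this potential plus the overshoot; the
  potential takes values in \<open>{-b..0}\<close>, so its telescoping sum costs at most \<open>b\<close>.\<close>

definition potential :: "nat \<Rightarrow> 'a \<Rightarrow> real" where
  "potential n \<omega> = indicator (alive n) \<omega> * (max 0 (S (n - 1) \<omega>) - b)"

lemma potential_bounds: "- b \<le> potential n \<omega>" "n \<ge> 1 \<Longrightarrow> potential n \<omega> \<le> 0"
proof -
  show "- b \<le> potential n \<omega>"
    using b by (auto simp: potential_def indicator_def)
  assume "n \<ge> 1"
  \<comment> \<open>\<open>alive n\<close> controls \<open>S\<close> only at times after
    \<open>w\<close>; up to \<open>w\<close> the statistic is 0.\<close>
  then show "potential n \<omega> \<le> 0"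
    using b S_eq_0[of "n - 1" \<omega>]
    by (cases "n - 1 \<le> w") (auto simp: potential_def indicator_def mem_alive_iff)
qed

text \<open>Without an alarm at \<open>n\<close> the potential gains the growth of
  \<open>max 0 (S n \<omega>)\<close>, which is at least the increment because reflection at 0 only
  raises the statistic. At an alarm it jumps to 0 and gains the remaining distance to
  \<open>b\<close>; the rest of the increment is the overshoot.\<close>

lemma incr_le_potential:
  assumes n: "w < n"
  shows "indicator (alive n) \<omega> * incr n \<omega> \<le> potential (Suc n) \<omega> - potential n \<omega> +
    indicator (alive n) \<omega> * max 0 (incr n \<omega> - (b - max 0 (S (n - 1) \<omega>)))"
proof (cases "\<omega> \<in> alive n")
  case True
  have "S n \<omega> = max 0 (S (n - 1) \<omega>) + incr n \<omega>"
    using S_Suc[of "n - 1" \<omega>] n by simp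
  then show ?thesis
    using True alive_Suc[OF n]
    by (cases "\<omega> \<in> alive (Suc n)") (auto simp: potential_def indicator_def)
next
  case False
  moreover from False have "\<omega> \<notin> alive (Suc n)" using alive_antimono[of n "Suc n"] by auto
  ultimately show ?thesis by (simp add: potential_def)
qed

lemma integrable_indicator_potential:
  assumes B: "B \<in> sets M" and k: "k \<ge> 1"
  shows "integrable M (\<lambda>\<omega>. indicator B \<omega> * potential k \<omega>)"
proof (rule integrable_const_bound[of _ b])
  have [measurable]: "S j \<in> borel_measurable M" for j by (rule F_measurable[OF measurable_S])
  have [measurable]: "alive k \<in> sets M" "B \<in> sets M" by (rule alive_sets B)+
  show "AE \<omega> in M. norm (indicator B \<omega> * potential k \<omega>) \<le> b"
  proof (rule AE_I2)
    fix \<omega>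
    show "norm (indicator B \<omega> * potential k \<omega>) \<le> b"
      using potential_bounds[of k \<omega>] b k by (cases "\<omega> \<in> B") auto
  qed
  show "(\<lambda>\<omega>. indicator B \<omega> * potential k \<omega>) \<in> borel_measurable M"
    unfolding potential_def by measurable
qed

text \<open>Cancelling the common terms leaves at most the first \<open>w\<close> terms of the
  unshifted sum.\<close>

lemma sum_shift_le:
  fixes p :: "nat \<Rightarrow> real"
  assumes "\<And>i. 0 \<le> p i" "\<And>i. p i \<le> c"
  shows "(\<Sum>j<N. p j) - (\<Sum>j<N. p (w + j)) \<le> real w * c"
proof -
  have "(\<Sum>j<N. p (w + j)) = (\<Sum>j\<in>{w..<w + N}. p j)"
    by (rule sum.reindex_bij_witness[of _ "\<lambda>j. j - w" "\<lambda>j. w + j"]) auto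
  moreover have "(\<Sum>j<N. p j) \<le> (\<Sum>j<w + N. p j)"
    by (rule sum_mono2) (auto simp: assms)
  moreover have "(\<Sum>j<w + N. p j) = (\<Sum>j<w. p j) + (\<Sum>j\<in>{w..<w + N}. p j)"
    by (simp add: lessThan_atLeast0 sum.atLeastLessThan_concat)
  moreover have "(\<Sum>j<w. p j) \<le> real w * c"
    using sum_bounded_above[of "{..<w}" p c] assms by simp
  ultimately show ?thesis by linarith
qed

text \<open>The event \<open>alive (n - w)\<close> is split into \<open>alive n\<close>, where the potential controls the increment,
  and the rest, which is still in \<open>F (n - 1)\<close>, so that the increment has conditional mean at most
  \<open>(norm \<theta>)\<^sup>2 / 2\<close> there.\<close>

lemma step_bound:
  assumes B: "B \<in> sets (F (\<nu> - 1))" and n: "\<nu> + w \<le> n"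
  shows "prob (B \<inter> alive (n - w)) * ((norm \<theta>)\<^sup>2 / 2 - mse / 2) \<le>
    (\<integral>\<omega>. indicator B \<omega> * potential (Suc n) \<omega> \<partial>M) - (\<integral>\<omega>. indicator B \<omega> * potential n \<omega> \<partial>M) +
    ((norm \<theta>)\<^sup>2 / 2 + 2) * (prob (B \<inter> alive n) - prob (B \<inter> alive (Suc n))) +
    (norm \<theta>)\<^sup>2 / 2 * (prob (B \<inter> alive (n - w)) - prob (B \<inter> alive n))"
proof -
  have wn: "w < n" using n \<nu> by simp
  \<comment> \<open>Since \<open>\<nu> - 1 \<le> n - w - 1\<close>, the history event
    \<open>B\<close> precedes the window.\<close>
  have B': "B \<in> sets (F (n - 1))" "B \<in> sets (F (n - w - 1))"
    by (rule F_mono[OF B], use n in simp)+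
  have [measurable]: "B \<in> sets M" by (rule F_sets[OF B])
  have [measurable]: "alive k \<in> sets M" for k by (rule alive_sets)
  have [measurable]: "S k \<in> borel_measurable M" for k by (rule F_measurable[OF measurable_S])
  have [measurable]: "S (n - 1) \<in> borel_measurable (F (n - 1))" by (rule measurable_S)
  let ?C = "B \<inter> alive n" and ?D = "B \<inter> alive (n - w)"
  let ?E = "?D - ?C"
  have C: "?C \<in> sets (F (n - 1))" using B' alive_F by auto
  have D: "?D \<in> sets (F (n - w - 1))" using B' alive_F[of "n - w"] by auto
  have D': "?D \<in> sets (F (n - 1))" by (rule F_mono[OF D]) simp
  have E: "?E \<in> sets (F (n - 1))" using C D' by auto
  have sub: "?C \<subseteq> ?D" using alive_antimono[of "n - w" n] by auto
  have sub': "B \<inter> alive (Suc n) \<subseteq> ?C" using alive_antimono[of n "Suc n"] by auto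
  have iE: "integrable M (\<lambda>\<omega>. indicator ?E \<omega> * incr n \<omega>)"
    and iC: "integrable M (\<lambda>\<omega>. indicator ?C \<omega> * incr n \<omega>)"
    using incr_has_integral[OF n] E C by (auto simp: has_bochner_integral_iff)
  note pot = integrable_indicator_potential[OF F_sets[OF B]]
  let ?c = "\<lambda>\<omega>. b - max 0 (S (n - 1) \<omega>)"
  have c0: "0 \<le> ?c \<omega>" if "\<omega> \<in> ?C" for \<omega>
    using potential_bounds(2)[of n \<omega>] that wn by (auto simp: potential_def)
  \<comment> \<open>The barrier is nonnegative on \<open>?C\<close>, so the overshoot is dominated
    by the absolute value of the increment.\<close>
  have iO: "integrable M (\<lambda>\<omega>. indicator ?C \<omega> * max 0 (incr n \<omega> - ?c \<omega>))"
  proof (rule Bochner_Integration.integrable_bound[OF integrable_abs[OF iC]])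
    have [measurable]: "incr n \<in> borel_measurable M" by (rule measurable_incr[OF wn])
    show "(\<lambda>\<omega>. indicator ?C \<omega> * max 0 (incr n \<omega> - ?c \<omega>)) \<in> borel_measurable M" by measurable
    show "AE \<omega> in M. norm (indicator ?C \<omega> * max 0 (incr n \<omega> - ?c \<omega>)) \<le> norm \<bar>indicator ?C \<omega> * incr n \<omega>\<bar>"
    proof (rule AE_I2)
      fix \<omega>
      show "norm (indicator ?C \<omega> * max 0 (incr n \<omega> - ?c \<omega>)) \<le> norm \<bar>indicator ?C \<omega> * incr n \<omega>\<bar>"
        using c0[of \<omega>] by (cases "\<omega> \<in> ?C") auto
    qed
  qed
  have "prob ?D * ((norm \<theta>)\<^sup>2 / 2 - mse / 2) = (\<integral>\<omega>. indicator ?D \<omega> * incr n \<omega> \<partial>M)"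
    by (rule integral_past_incr[OF n D, symmetric])
  also have "\<dots> = (\<integral>\<omega>. indicator ?C \<omega> * incr n \<omega> + indicator ?E \<omega> * incr n \<omega> \<partial>M)"
    using sub by (intro Bochner_Integration.integral_cong) (auto simp: indicator_def)
  also have "\<dots> = (\<integral>\<omega>. indicator ?C \<omega> * incr n \<omega> \<partial>M) + (\<integral>\<omega>. indicator ?E \<omega> * incr n \<omega> \<partial>M)"
    by (rule Bochner_Integration.integral_add[OF iC iE])
  also have "(\<integral>\<omega>. indicator ?E \<omega> * incr n \<omega> \<partial>M) \<le> (norm \<theta>)\<^sup>2 / 2 * (prob ?D - prob ?C)"
    using integral_incr_le[OF n E] finite_measure_Diff[of ?D ?C] sub by (simp add: mult.commute)
  also have "(\<integral>\<omega>. indicator ?C \<omega> * incr n \<omega> \<partial>M) \<le>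
      (\<integral>\<omega>. indicator B \<omega> * potential (Suc n) \<omega> - indicator B \<omega> * potential n \<omega> +
        indicator ?C \<omega> * max 0 (incr n \<omega> - ?c \<omega>) \<partial>M)"
  proof (rule integral_mono)
    show "integrable M (\<lambda>\<omega>. indicator B \<omega> * potential (Suc n) \<omega> - indicator B \<omega> * potential n \<omega> +
        indicator ?C \<omega> * max 0 (incr n \<omega> - ?c \<omega>))"
      using wn by (intro Bochner_Integration.integrable_add Bochner_Integration.integrable_diff pot iO) auto
    fix \<omega>
    show "indicator ?C \<omega> * incr n \<omega> \<le>
        indicator B \<omega> * potential (Suc n) \<omega> - indicator B \<omega> * potential n \<omega> +
        indicator ?C \<omega> * max 0 (incr n \<omega> - ?c \<omega>)"
      using incr_le_potential[OF wn, of \<omega>] by (cases "\<omega> \<in> B") (simp_all add: indicator_inter_arith)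
  qed (rule iC)
  also have "\<dots> = (\<integral>\<omega>. indicator B \<omega> * potential (Suc n) \<omega> \<partial>M) -
      (\<integral>\<omega>. indicator B \<omega> * potential n \<omega> \<partial>M) +
      (\<integral>\<omega>. indicator ?C \<omega> * max 0 (incr n \<omega> - ?c \<omega>) \<partial>M)"
    using pot[of n] pot[of "Suc n"] iO wn by simp
  also have "(\<integral>\<omega>. indicator ?C \<omega> * max 0 (incr n \<omega> - ?c \<omega>) \<partial>M) \<le>
      ((norm \<theta>)\<^sup>2 / 2 + 2) * prob {\<omega> \<in> ?C. ?c \<omega> < incr n \<omega>}"
    by (rule integral_overshoot_le[OF n C _ c0]) measurable
  \<comment> \<open>Crossing the barrier is the alarm at time \<open>n\<close>, so its probability
    is a difference that telescopes over \<open>n\<close>.\<close>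
  also have "{\<omega> \<in> ?C. ?c \<omega> < incr n \<omega>} = ?C - B \<inter> alive (Suc n)"
    using alive_Suc[OF wn] S_Suc[of "n - 1"] wn by auto
  also have "prob \<dots> = prob ?C - prob (B \<inter> alive (Suc n))"
    using sub' by (intro finite_measure_Diff) auto
  finally show ?thesis by simp
qed

text \<open>Three sums collapse: the potential to at most \<open>b\<close>, the crossings to at most
  one \<open>I + 2\<close>, because an alarm occurs only once, and the shift to at most
  \<open>w\<close> times \<open>I\<close>, all multiplied by \<open>prob B\<close>. The terms at the
  upper end have the favourable sign and are dropped, which frees the bound of
  \<open>N\<close>.\<close>

lemma alive_sum_le:
  assumes B: "B \<in> sets (F (\<nu> - 1))"
  shows "((norm \<theta>)\<^sup>2 / 2 - mse / 2) * (\<Sum>j<N. prob (B \<inter> alive (\<nu> + j))) \<le>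
    (b + (real w + 1) * ((norm \<theta>)\<^sup>2 / 2) + 2) * prob B"
proof -
  define p where "p j = prob (B \<inter> alive (\<nu> + j))" for j
  define \<psi> where "\<psi> n = (\<integral>\<omega>. indicator B \<omega> * potential n \<omega> \<partial>M)" for n
  let ?I = "(norm \<theta>)\<^sup>2 / 2"
  have BM: "B \<in> sets M" by (rule F_sets[OF B])
  have p: "0 \<le> p j" "p j \<le> prob B" for j
    unfolding p_def using BM by (simp, intro finite_measure_mono, auto)
  have "(?I - mse / 2) * (\<Sum>j<N. p j) = (\<Sum>j<N. p j * (?I - mse / 2))"
    unfolding mult.commute[of "?I - mse / 2"] sum_distrib_right ..
  also have "\<dots> \<le> (\<Sum>j<N. (\<psi> (\<nu> + w + Suc j) - \<psi> (\<nu> + w + j)) + (?I + 2) * (p (w + j) - p (w + Suc j)) +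
      ?I * (p j - p (w + j)))"
  proof (rule sum_mono)
    fix j
    show "p j * (?I - mse / 2) \<le> (\<psi> (\<nu> + w + Suc j) - \<psi> (\<nu> + w + j)) +
        (?I + 2) * (p (w + j) - p (w + Suc j)) + ?I * (p j - p (w + j))"
    proof -
      have shift: "\<nu> + w + j - w = \<nu> + j" by simp
      show ?thesis
        using step_bound[OF B le_add1[of "\<nu> + w" j], unfolded shift]
        by (simp only: p_def \<psi>_def add.assoc add_Suc_right)
    qed
  qed
  also have "\<dots> = (\<Sum>j<N. \<psi> (\<nu> + w + Suc j) - \<psi> (\<nu> + w + j)) +
      (?I + 2) * (\<Sum>j<N. p (w + j) - p (w + Suc j)) + ?I * ((\<Sum>j<N. p j) - (\<Sum>j<N. p (w + j)))"
    by (simp only: sum.distrib sum_distrib_left[symmetric] sum_subtractf)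
  also have "(\<Sum>j<N. \<psi> (\<nu> + w + Suc j) - \<psi> (\<nu> + w + j)) = \<psi> (\<nu> + w + N) - \<psi> (\<nu> + w)"
    using sum_lessThan_telescope[of "\<lambda>j. \<psi> (\<nu> + w + j)" N] by simp
  also have "(\<Sum>j<N. p (w + j) - p (w + Suc j)) = p w - p (w + N)"
    using sum_lessThan_telescope'[of "\<lambda>j. p (w + j)" N] by simp
  also have "\<psi> (\<nu> + w + N) - \<psi> (\<nu> + w) + (?I + 2) * (p w - p (w + N)) +
      ?I * ((\<Sum>j<N. p j) - (\<Sum>j<N. p (w + j))) \<le>
      b * prob B + (?I + 2) * prob B + ?I * (real w * prob B)"
  proof (intro add_mono mult_left_mono)
    have "0 \<le> (\<integral>\<omega>. - (indicator B \<omega> * potential (\<nu> + w + N) \<omega>) \<partial>M)"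
      using \<nu> potential_bounds(2)[of "\<nu> + w + N"]
      by (intro Bochner_Integration.integral_nonneg) (auto simp: indicator_def)
    then have "\<psi> (\<nu> + w + N) \<le> 0" by (simp add: \<psi>_def)
    moreover have "- \<psi> (\<nu> + w) \<le> b * prob B"
    proof -
      have "integrable M (\<lambda>\<omega>. - (indicator B \<omega> * potential (\<nu> + w) \<omega>))"
        using integrable_indicator_potential[OF BM, of "\<nu> + w"] \<nu> by simp
      moreover have "integrable M (\<lambda>\<omega>. indicator B \<omega> * b)"
        using BM by (intro integrable_mult_left integrable_real_indicator) (auto simp: emeasure_eq_measure)
      ultimately have "(\<integral>\<omega>. - (indicator B \<omega> * potential (\<nu> + w) \<omega>) \<partial>M) \<le> (\<integral>\<omega>. indicator B \<omega> * b \<partial>M)"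
      proof (rule integral_mono)
        fix \<omega>
        show "- (indicator B \<omega> * potential (\<nu> + w) \<omega>) \<le> indicator B \<omega> * b"
          using potential_bounds(1)[of "\<nu> + w" \<omega>] by (cases "\<omega> \<in> B") auto
      qed
      then show ?thesis
        using BM sets.sets_into_space[OF BM] by (simp add: \<psi>_def mult.commute Int_absorb2)
    qed
    ultimately show "\<psi> (\<nu> + w + N) - \<psi> (\<nu> + w) \<le> b * prob B" by linarith
    show "p w - p (w + N) \<le> prob B" using p[of w] p[of "w + N"] by linarith
    show "(\<Sum>j<N. p j) - (\<Sum>j<N. p (w + j)) \<le> real w * prob B"
      by (rule sum_shift_le[OF p])
  qed auto
  also have "\<dots> = (b + (real w + 1) * ?I + 2) * prob B" by (simp add: algebra_simps)
  finally show ?thesis unfolding p_def .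
qed

section \<open>From survival probabilities to the conditional delay\<close>

definition delay_bound :: real where
  "delay_bound = (b + (real w + 1) * ((norm \<theta>)\<^sup>2 / 2) + 2) / ((norm \<theta>)\<^sup>2 / 2 - mse / 2)"

lemma nn_integral_delay_le:
  assumes pos: "(norm \<theta>)\<^sup>2 / 2 - mse / 2 > 0" and B: "B \<in> sets (F (\<nu> - 1))"
  shows "(\<integral>\<^sup>+\<omega>. indicator B \<omega> * ennreal_of_enat (T \<omega> + 1 - enat \<nu>) \<partial>M) \<le>
    ennreal delay_bound * emeasure M B"
proof -
  have BM[measurable]: "B \<in> sets M" by (rule F_sets[OF B])
  have bound_nonneg: "delay_bound \<ge> 0"
    unfolding delay_bound_def using pos b by (intro divide_nonneg_pos) auto
  \<comment> \<open>The indicator becomes the value 0 of an \<open>enat\<close>-valued function, to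
    which the tail sum formula applies.\<close>
  let ?f = "\<lambda>\<omega>. if \<omega> \<in> B then T \<omega> + 1 - enat \<nu> else 0"
  have f: "?f \<in> measurable M (count_space UNIV)"
    by (intro measurable_If_set measurable_compose[OF measurable_T, of "\<lambda>t. t + 1 - enat \<nu>"]) auto
  have "(\<integral>\<^sup>+\<omega>. indicator B \<omega> * ennreal_of_enat (T \<omega> + 1 - enat \<nu>) \<partial>M) =
      (\<integral>\<^sup>+\<omega>. ennreal_of_enat (?f \<omega>) \<partial>M)"
    by (intro nn_integral_cong) (simp add: indicator_def)
  also have "\<dots> = (\<Sum>t. emeasure M {\<omega> \<in> space M. enat t < ?f \<omega>})"
    by (rule nn_integral_enat_function[OF f])
  also have "\<dots> = (\<Sum>t. ennreal (prob (B \<inter> alive (\<nu> + t))))"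
  proof (intro suminf_cong)
    fix t
    \<comment> \<open>A delay above \<open>t\<close> means no alarm before \<open>\<nu> + t\<close>;
      for \<open>u = \<infinity>\<close> both sides hold.\<close>
    have "enat t < u + 1 - enat \<nu> \<longleftrightarrow> enat (\<nu> + t) \<le> u" for u
      by (cases u) (auto simp: one_enat_def)
    then have "{\<omega> \<in> space M. enat t < ?f \<omega>} = B \<inter> alive (\<nu> + t)"
      using sets.sets_into_space[OF BM] by (auto simp: alive_def split: if_splits)
    then show "emeasure M {\<omega> \<in> space M. enat t < ?f \<omega>} = ennreal (prob (B \<inter> alive (\<nu> + t)))"
      by (simp add: emeasure_eq_measure)
  qed
  also have "\<dots> \<le> ennreal (delay_bound * prob B)"
  proof (rule suminf_le_const)
    show "summable (\<lambda>t. ennreal (prob (B \<inter> alive (\<nu> + t))))" by simp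
    fix N
    have "(\<Sum>t<N. prob (B \<inter> alive (\<nu> + t))) \<le> delay_bound * prob B"
      using alive_sum_le[OF B, of N] pos unfolding delay_bound_def by (simp add: pos_le_divide_eq mult.commute)
    then show "(\<Sum>t<N. ennreal (prob (B \<inter> alive (\<nu> + t)))) \<le> ennreal (delay_bound * prob B)"
      by (subst sum_ennreal) (auto intro: ennreal_leI)
  qed
  also have "\<dots> = ennreal delay_bound * emeasure M B"
    using bound_nonneg by (simp add: emeasure_eq_measure ennreal_mult)
  finally show ?thesis .
qed

text \<open>The bound is tested on the set \<open>B\<close> where the conditional expectation
  exceeds it. As \<open>B\<close> lies in \<open>F (\<nu> - 1)\<close>, the conditional expectation
  can be exchanged for the delay itself there, and the integrated bound forces \<open>B\<close> to
  be null.\<close>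

lemma conditional_delay:
  assumes pos: "(norm \<theta>)\<^sup>2 / 2 - mse / 2 > 0"
  shows "esssup M (nn_cond_exp M (F (\<nu> - 1)) (\<lambda>\<omega>. ennreal_of_enat (T \<omega> + 1 - enat \<nu>))) \<le>
    ennreal delay_bound"
proof (rule esssup_I)
  let ?G = "F (\<nu> - 1)"
  let ?f = "\<lambda>\<omega>. ennreal_of_enat (T \<omega> + 1 - enat \<nu>)"
  let ?h = "nn_cond_exp M ?G ?f"
  interpret sub: finite_measure_subalgebra M ?G
    by unfold_locales (rule subalgebra_F)
  have f: "?f \<in> borel_measurable M"
    by (rule measurable_compose[OF measurable_T]) simp
  have h[measurable]: "?h \<in> borel_measurable ?G" by (rule borel_measurable_nn_cond_exp)
  show hM: "?h \<in> borel_measurable M" by (rule F_measurable[OF h])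
  define B where "B = {\<omega> \<in> space M. ennreal delay_bound < ?h \<omega>}"
  have BG: "B \<in> sets ?G"
  proof -
    have "{\<omega> \<in> space ?G. ennreal delay_bound < ?h \<omega>} \<in> sets ?G" by measurable
    then show ?thesis by (simp add: B_def)
  qed
  have BM[measurable]: "B \<in> sets M" by (rule F_sets[OF BG])
  have [measurable]: "?h \<in> borel_measurable M" by (rule hM)
  have eq: "(\<integral>\<^sup>+\<omega>. indicator B \<omega> * ?h \<omega> \<partial>M) = (\<integral>\<^sup>+\<omega>. indicator B \<omega> * ?f \<omega> \<partial>M)"
    using BG by (intro sub.nn_cond_exp_intg f) auto
  have le: "(\<integral>\<^sup>+\<omega>. indicator B \<omega> * ?h \<omega> \<partial>M) \<le> (\<integral>\<^sup>+\<omega>. ennreal delay_bound * indicator B \<omega> \<partial>M)"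
    unfolding eq using nn_integral_delay_le[OF pos BG] by (simp add: nn_integral_cmult_indicator)
  show "AE \<omega> in M. ?h \<omega> \<le> ennreal delay_bound"
  proof -
    let ?g = "\<lambda>\<omega>. ennreal delay_bound * indicator B \<omega>"
    \<comment> \<open>The excess over the bound is positive on \<open>B\<close> yet integrates to 0.
      Subtracting the integrals is legitimate because \<open>?g\<close> has a finite one.\<close>
    have "AE \<omega> in M. indicator B \<omega> * ?h \<omega> - ?g \<omega> = 0"
    proof (subst nn_integral_0_iff_AE[symmetric])
      show "(\<lambda>\<omega>. indicator B \<omega> * ?h \<omega> - ?g \<omega>) \<in> borel_measurable M" by measurable
      have "(\<integral>\<^sup>+\<omega>. indicator B \<omega> * ?h \<omega> - ?g \<omega> \<partial>M) =
          (\<integral>\<^sup>+\<omega>. indicator B \<omega> * ?h \<omega> \<partial>M) - (\<integral>\<^sup>+\<omega>. ?g \<omega> \<partial>M)"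
      proof (rule nn_integral_diff)
        show "(\<integral>\<^sup>+\<omega>. ?g \<omega> \<partial>M) \<noteq> \<infinity>"
          by (simp add: nn_integral_cmult_indicator emeasure_eq_measure ennreal_mult_eq_top_iff)
        show "AE \<omega> in M. ?g \<omega> \<le> indicator B \<omega> * ?h \<omega>"
          by (auto simp: B_def indicator_def)
      qed measurable
      also have "\<dots> = 0"
        using le by (intro diff_eq_0_ennreal le_less_trans[OF le])
          (simp_all add: nn_integral_cmult_indicator emeasure_eq_measure ennreal_mult_less_top)
      finally show "(\<integral>\<^sup>+\<omega>. indicator B \<omega> * ?h \<omega> - ?g \<omega> \<partial>M) = 0" .
    qed
    with AE_space show ?thesis
    proof eventually_elim
      case (elim \<omega>)
      then show ?case
        by (cases "\<omega> \<in> B") (auto simp: B_def diff_eq_0_iff_ennreal)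
    qed
  qed
qed

end

section \<open>Specialisation to the change-point model\<close>

lemma gaussian_obs_of_gaussian_observations:
  "gaussian_observations M X \<mu> \<Longrightarrow> gaussian_obs M X \<mu>"
  by (simp add: gaussian_observations_def gaussian_obs_def gaussian_obs_axioms_def)

theorem theorem1:
  fixes \<Theta> :: "(real ^ 'k) set"
    and Pinf :: "'a measure"
    and P :: "nat \<Rightarrow> real ^ 'k \<Rightarrow> 'a measure"
    and X :: "nat \<Rightarrow> 'a \<Rightarrow> real ^ 'k"
    and est :: "(nat \<Rightarrow> real ^ 'k) \<Rightarrow> real ^ 'k"
    and \<theta> :: "real ^ 'k"
    and w :: nat
    and b \<gamma> :: real
  assumes "CARD('k) \<ge> 3"
    and "\<Theta> \<subseteq> UNIV - {0}"
    and "change_point_model \<Theta> Pinf P X"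
    and "\<theta> \<in> \<Theta>"
    and "w \<ge> 1"
    and "est \<in> borel_measurable (PiM {..<w} (\<lambda>_. borel))"
    and "\<gamma> \<ge> 1"
    and "b = ln \<gamma>"
    and "ereal (kl_divergence \<theta>) - enn2ereal (window_mse P X w est \<theta>) / 2 > 0"
  shows "(\<integral>\<^sup>+ \<omega>. ennreal_of_enat (wl_cusum_time w est X b \<omega>) \<partial>Pinf) \<ge> ennreal \<gamma> \<and>
    enn2ereal (lorden_delay P X \<theta> (wl_cusum_time w est X b))
      \<le> ereal (b + (real w + 1) * kl_divergence \<theta> + 2) /
          (ereal (kl_divergence \<theta>) - enn2ereal (window_mse P X w est \<theta>) / 2)"
proof
  have inf: "gaussian_obs Pinf X (\<lambda>_. 0)"
    and post: "\<And>\<nu>. \<nu> \<ge> 1 \<Longrightarrow> gaussian_obs (P \<nu> \<theta>) X (\<lambda>n. if n < \<nu> then 0 else \<theta>)"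
    using assms(3,4) unfolding change_point_model_def
    by (blast intro: gaussian_obs_of_gaussian_observations)+
  have b: "b \<ge> 0" "exp b = \<gamma>" using assms(7,8) by auto
  have "wl_cusum_test Pinf X (\<lambda>_. 0) w est b"
    using inf assms(5,6) b by (simp add: wl_cusum_test_def wl_cusum_test_axioms_def)
  from wl_cusum_test.average_run_length[OF this]
  show "(\<integral>\<^sup>+ \<omega>. ennreal_of_enat (wl_cusum_time w est X b \<omega>) \<partial>Pinf) \<ge> ennreal \<gamma>"
    by (simp add: b)

  \<comment> \<open>An infinite error would turn the difference assumed positive into
    \<open>-\<infinity>\<close>.\<close>
  have "window_mse P X w est \<theta> \<noteq> \<top>"
    using assms(9) by (auto simp: enn2ereal_top)
  then obtain mse where mse: "window_mse P X w est \<theta> = ennreal mse" "mse \<ge> 0"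
    by (cases "window_mse P X w est \<theta>") auto
  have mse_diff: "ereal (kl_divergence \<theta>) - enn2ereal (window_mse P X w est \<theta>) / 2 =
      ereal ((norm \<theta>)\<^sup>2 / 2 - mse / 2)"
    using mse by (simp add: kl_divergence_def enn2ereal_ennreal)
  have pos: "(norm \<theta>)\<^sup>2 / 2 - mse / 2 > 0" using assms(9) unfolding mse_diff by simp
  \<comment> \<open>Under \<open>P 1 \<theta>\<close> the first window already lies after the
    change, so the error defined there is that of the product law shared by all
    \<open>\<nu>\<close>.\<close>
  have window: "(\<integral>\<^sup>+y. ennreal ((norm (\<theta> - est y))\<^sup>2) \<partial>PiM {..<w} (\<lambda>_. mvn_measure \<theta>)) = ennreal mse"
    using gaussian_obs.nn_integral_window[OF post[of 1] assms(5,6),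
        of "\<lambda>x. ennreal ((norm (\<theta> - x))\<^sup>2)" 0 \<theta>] mse(1)
    by (simp add: window_mse_def)
  have "lorden_delay P X \<theta> (wl_cusum_time w est X b) \<le>
      ennreal ((b + (real w + 1) * ((norm \<theta>)\<^sup>2 / 2) + 2) / ((norm \<theta>)\<^sup>2 / 2 - mse / 2))"
    (is "_ \<le> ennreal ?D")
    unfolding lorden_delay_def
  proof (rule SUP_least)
    fix \<nu> :: nat assume \<nu>: "\<nu> \<in> {1..}"
    then interpret wl_cusum_change "P \<nu> \<theta>" X "\<lambda>n. if n < \<nu> then 0 else \<theta>" w est b \<nu> \<theta> mse
      using post[of \<nu>] assms(5,6) b mse window
      by (simp add: wl_cusum_change_def wl_cusum_change_axioms_def wl_cusum_test_def
          wl_cusum_test_axioms_def)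
    show "esssup (P \<nu> \<theta>) (nn_cond_exp (P \<nu> \<theta>) (obs_filtration (space (P \<nu> \<theta>)) X (\<nu> - 1))
           (\<lambda>\<omega>. ennreal_of_enat (wl_cusum_time w est X b \<omega> + 1 - enat \<nu>))) \<le> ennreal ?D"
      using conditional_delay[OF pos] unfolding delay_bound_def .
  qed
  then have "enn2ereal (lorden_delay P X \<theta> (wl_cusum_time w est X b)) \<le> enn2ereal (ennreal ?D)"
    by (simp add: less_eq_ennreal.rep_eq)
  also have "\<dots> = ereal ?D"
    using pos b by (intro enn2ereal_ennreal divide_nonneg_pos) auto
  also have "\<dots> = ereal (b + (real w + 1) * kl_divergence \<theta> + 2) /
      (ereal (kl_divergence \<theta>) - enn2ereal (window_mse P X w est \<theta>) / 2)"
    unfolding mse_diff using pos by (simp add: kl_divergence_def)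
  finally show "enn2ereal (lorden_delay P X \<theta> (wl_cusum_time w est X b))
      \<le> ereal (b + (real w + 1) * kl_divergence \<theta> + 2) /
          (ereal (kl_divergence \<theta>) - enn2ereal (window_mse P X w est \<theta>) / 2)" .
qed

end
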